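(* Let $-A$ be the generator of a bounded $C_0$-semigroup $(T(s))_{s\ge0}$ on a Banach space $X$ and let $\alpha\in(0,1)$. (a) For each $x\in\operatorname{ran}(A^\alpha)$, $\|\mathcal C_t(A)x\|=O(t^{-\alpha})$ as $t\to\infty$. (b) If the semigroup is mean ergodic, then for each $x\in\operatorname{ran}(A^\alpha)$, $\|\mathcal C_t(A)x\|=o(t^{-\alpha})$ as $t\to\infty$. (c) If $0$ is an accumulation point of $\sigma(A)$, then for any decreasing function $\epsilon:(0,\infty)\to(0,\infty)$ with $\lim_{t\to\infty}\epsilon(t)=0$ there exists $y\in\operatorname{ran}(A^\alpha)$ with $\sup_{t\ge1}\frac{t^\alpha\|\mathcal C_t(A)y\|}{\epsilon(t)}=\infty$.
   Context: $A^\alpha$ is the fractional power of $A$; equivalently, $A^\alpha=g(A)$ for the Bernstein function $g(z)=z^\alpha=\int_0^\infty(1-e^{-zs})\frac{\alpha}{\Gamma(1-\alpha)}s^{-\alpha-1}\,\mathrm ds$ in the extended Hille–Phillips calculus for $A$. Cesàro means: $\mathcal C_t(A)x=\frac1t\int_0^tT(s)x\,\mathrm ds$. The semigroup is mean ergodic if $X=\ker(A)\oplus\overline{\operatorname{ran}}(A)$. *)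

theory Defs
  imports "HOL-Analysis.Analysis" "HOL-Library.Landau_Symbols"
begin

text \<open>A complex Banach space is modelled as a real Banach space together with a
complex structure J (multiplication by the imaginary unit).\<close>

definition complex_structure :: "('a::banach \<Rightarrow> 'a) \<Rightarrow> bool" where
  "complex_structure J \<longleftrightarrow> bounded_linear J \<and> (\<forall>x. J (J x) = - x) \<and>
     (\<forall>a b x. norm (a *\<^sub>R x + b *\<^sub>R J x) = cmod (Complex a b) * norm x)"

definition cscale :: "('a::banach \<Rightarrow> 'a) \<Rightarrow> complex \<Rightarrow> 'a \<Rightarrow> 'a" where
  "cscale J c x = Re c *\<^sub>R x + Im c *\<^sub>R J x"

definition bounded_C0_semigroup :: "('a::banach \<Rightarrow> 'a) \<Rightarrow> (real \<Rightarrow> 'a \<Rightarrow> 'a) \<Rightarrow> bool" where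
  "bounded_C0_semigroup J T \<longleftrightarrow>
     (\<forall>t\<ge>0. bounded_linear (T t) \<and> (\<forall>x. T t (J x) = J (T t x))) \<and>
     (\<forall>x. T 0 x = x) \<and>
     (\<forall>s t x. 0 \<le> s \<longrightarrow> 0 \<le> t \<longrightarrow> T (s + t) x = T s (T t x)) \<and>
     (\<forall>x. continuous_on {0..} (\<lambda>t. T t x)) \<and>
     (\<exists>M. \<forall>t\<ge>0. \<forall>x. norm (T t x) \<le> M * norm x)"

definition neg_gen_rel :: "(real \<Rightarrow> 'a::banach \<Rightarrow> 'a) \<Rightarrow> 'a \<Rightarrow> 'a \<Rightarrow> bool" where
  "neg_gen_rel T x y \<longleftrightarrow> ((\<lambda>h. inverse h *\<^sub>R (T h x - x)) \<longlongrightarrow> y) (at_right 0)"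

definition opA_dom :: "(real \<Rightarrow> 'a::banach \<Rightarrow> 'a) \<Rightarrow> 'a set" where
  "opA_dom T = {x. \<exists>y. neg_gen_rel T x y}"

definition opA :: "(real \<Rightarrow> 'a::banach \<Rightarrow> 'a) \<Rightarrow> 'a \<Rightarrow> 'a" where
  "opA T x = - (THE y. neg_gen_rel T x y)"

definition opA_ker :: "(real \<Rightarrow> 'a::banach \<Rightarrow> 'a) \<Rightarrow> 'a set" where
  "opA_ker T = {x \<in> opA_dom T. opA T x = 0}"

definition opA_ran :: "(real \<Rightarrow> 'a::banach \<Rightarrow> 'a) \<Rightarrow> 'a set" where
  "opA_ran T = opA T ` opA_dom T"

definition mean_ergodic :: "(real \<Rightarrow> 'a::banach \<Rightarrow> 'a) \<Rightarrow> bool" where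
  "mean_ergodic T \<longleftrightarrow>
     (\<forall>x. \<exists>u v. u \<in> opA_ker T \<and> v \<in> closure (opA_ran T) \<and> x = u + v) \<and>
     opA_ker T \<inter> closure (opA_ran T) = {0}"

definition resolvent_set :: "('a::banach \<Rightarrow> 'a) \<Rightarrow> (real \<Rightarrow> 'a \<Rightarrow> 'a) \<Rightarrow> complex set" where
  "resolvent_set J T = {z. \<exists>R. bounded_linear R \<and> (\<forall>y. R (J y) = J (R y)) \<and>
      (\<forall>y. R y \<in> opA_dom T \<and> cscale J z (R y) - opA T (R y) = y) \<and>
      (\<forall>x \<in> opA_dom T. R (cscale J z x - opA T x) = x)}"

definition spectrum_A :: "('a::banach \<Rightarrow> 'a) \<Rightarrow> (real \<Rightarrow> 'a \<Rightarrow> 'a) \<Rightarrow> complex set" where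
  "spectrum_A J T = UNIV - resolvent_set J T"

text \<open>Fractional power A^alpha: closure of the operator given on the core D(A) by the
Bernstein/Phillips formula  A^alpha x = int_0^infty (x - T(s)x) alpha/Gamma(1-alpha) s^(-alpha-1) ds.\<close>

definition frac_pre :: "(real \<Rightarrow> 'a::banach \<Rightarrow> 'a) \<Rightarrow> real \<Rightarrow> 'a \<Rightarrow> 'a" where
  "frac_pre T \<alpha> x = integral {0<..}
     (\<lambda>s. ((\<alpha> / Gamma (1 - \<alpha>)) * s powr (- \<alpha> - 1)) *\<^sub>R (x - T s x))"

definition frac_graph :: "(real \<Rightarrow> 'a::banach \<Rightarrow> 'a) \<Rightarrow> real \<Rightarrow> ('a \<times> 'a) set" where
  "frac_graph T \<alpha> = closure {(x, frac_pre T \<alpha> x) | x. x \<in> opA_dom T}"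

definition frac_ran :: "(real \<Rightarrow> 'a::banach \<Rightarrow> 'a) \<Rightarrow> real \<Rightarrow> 'a set" where
  "frac_ran T \<alpha> = snd ` frac_graph T \<alpha>"

definition cesaro :: "(real \<Rightarrow> 'a::banach \<Rightarrow> 'a) \<Rightarrow> real \<Rightarrow> 'a \<Rightarrow> 'a" where
  "cesaro T t x = (1 / t) *\<^sub>R integral {0..t} (\<lambda>s. T s x)"

end

theory Submission
  imports Defs
begin

text \<open>
  On the domain of A, the difference \<open>x - T s x\<close> has Cesaro mean at time t of norm at most a multiple of
  \<open>min s t / t\<close>; integrating this against \<open>s powr (- \<alpha> - 1)\<close> shows that the Cesaro mean of \<open>A^\<alpha> x\<close> is at most a
  multiple of \<open>t powr (- \<alpha>) * norm x\<close>. The estimate extends to the closed graph and gives (a). In the mean ergodic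
  case x may be taken in the closure of ran A and approximated there by multiples of \<open>z - T h z\<close>, for
  which the Cesaro means of \<open>A^\<alpha> (z - T h z)\<close> are of order \<open>1 / t\<close>; this gives (b). For (c), circles around
  0 through points of the spectrum contain approximate eigenvalues z. At time \<open>t = 1 / cmod z\<close> an
  approximate eigenvector attains the rate \<open>t powr (- \<alpha>)\<close> up to a fixed factor, and a gliding hump
  adds such vectors up to one y that decays more slowly than \<open>\<epsilon> t * t powr (- \<alpha>)\<close>.
\<close>

section \<open>Weighted improper integrals\<close>

text \<open>The operator A^\<alpha> is given by an integral only on the domain of A and by closure
  beyond it, so a bound survives in the limit only if it involves \<open>norm x\<close> and not
  \<open>norm (opA T x)\<close>. In the Cesaro mean the factor \<open>1 / t\<close> takes the place
  of smoothness of x near \<open>s = 0\<close>, and with the cut at \<open>s = t\<close> both halves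
  scale as \<open>t powr (- \<alpha>)\<close>. A point of the spectrum may carry no approximate
  eigenvector. The circle provides a substitute of the same modulus, which fixes the time at which
  the rate is attained. On an exact eigenvector A^\<alpha> and the Cesaro mean would act as two
  scalar integrals, the symbols; on an approximate one both errors are controlled by the twisted
  orbit exp (z u) T u x, whose derivative contains only zx - Ax. The humps have size \<rho>^n for a
  fixed \<rho>. Slowness comes from the freedom in the times: since the spectrum accumulates at 0, t
  n can be postponed until \<epsilon> (t n) is below \<rho>^n / (n + 1).\<close>

lemma has_integral_Icc_imp_Ioc:
  fixes f :: "real \<Rightarrow> 'b::banach"
  assumes "(f has_integral i) {a..b}"
  shows "(f has_integral i) {a<..b}"
proof (rule has_integral_spike_set_eq[THEN iffD1, OF _ _ assms])
  have "{x \<in> {a..b} - {a<..b}. f x \<noteq> 0} \<subseteq> {a}" by force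
  then show "negligible {x \<in> {a..b} - {a<..b}. f x \<noteq> 0}"
    by (rule negligible_subset[OF negligible_sing])
  have "{x \<in> {a<..b} - {a..b}. f x \<noteq> 0} = {}" by force
  then show "negligible {x \<in> {a<..b} - {a..b}. f x \<noteq> 0}" by (simp only: negligible_empty)
qed

text \<open>The primitive \<open>G\<close> of the majorant is continuous down to 0 because
  \<open>a < 1\<close>, and it acts as a modulus of continuity for \<open>F\<close>. So
  \<open>F\<close> extends continuously to 0, and the extension \<open>H\<close>, an antiderivative
  of \<open>- f\<close> in the interior, admits the fundamental theorem of calculus on the closed
  interval.\<close>

lemma integrable_near_0:
  fixes f :: "real \<Rightarrow> 'b::banach"
  assumes a: "a < 1" and b: "0 < b" and cont: "continuous_on {0<..b} f"
    and le: "\<And>s. 0 < s \<Longrightarrow> s \<le> b \<Longrightarrow> norm (f s) \<le> p * s powr (- a)"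
  shows "f integrable_on {0<..b}" "norm (integral {0<..b} f) \<le> p * (b powr (1 - a) / (1 - a))"
proof -
  define F where "F s = integral {s..b} f" for s
  define G where "G s = p * (s powr (1 - a) / (1 - a))" for s :: real
  have cont': "continuous_on {s..t} f" if "0 < s" "t \<le> b" for s t
    by (rule continuous_on_subset[OF cont]) (use that in auto)
  have G: "((\<lambda>s. p * s powr (- a)) has_integral (G t - G s)) {s..t}" if "0 < s" "s \<le> t" for s t
  proof (rule fundamental_theorem_of_calculus)
    fix x assume "x \<in> {s..t}"
    then have "x > 0" using that by auto
    then have "(G has_real_derivative p * x powr (- a)) (at x within {s..t})"
      unfolding G_def using a by (auto intro!: derivative_eq_intros)
    then show "(G has_vector_derivative p * x powr - a) (at x within {s..t})"
      by (simp add: has_real_derivative_iff_has_vector_derivative)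
  qed (use that in auto)
  have diff: "norm (F s - F t) \<le> \<bar>G s - G t\<bar>" if "0 < s" "s \<le> t" "t \<le> b" for s t
  proof -
    have "F s - F t = integral {s..t} f"
      unfolding F_def
      using Henstock_Kurzweil_Integration.integral_combine[where a=s and c=t and b=b and f=f] that integrable_continuous_real[OF cont'[of s b]]
      by (simp add: algebra_simps)
    also have "norm \<dots> \<le> integral {s..t} (\<lambda>s. p * s powr (- a))"
      using that by (intro integral_norm_bound_integral integrable_continuous_real cont' le
          has_integral_integrable[OF G]) auto
    also have "\<dots> = G t - G s" using that by (intro integral_unique G)
    finally show ?thesis by linarith
  qed
  have contG: "continuous_on {0..b} G"
    unfolding G_def using a by (intro continuous_intros continuous_on_powr') auto
  have "uniformly_continuous_on {0<..b} F"
    unfolding uniformly_continuous_on_def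
  proof (intro allI impI)
    fix e :: real assume "e > 0"
    moreover have "uniformly_continuous_on {0..b} G"
      using contG by (intro compact_uniformly_continuous) auto
    ultimately obtain d where d: "d > 0" "\<And>s t. s \<in> {0..b} \<Longrightarrow> t \<in> {0..b} \<Longrightarrow> dist t s < d \<Longrightarrow> dist (G t) (G s) < e"
      unfolding uniformly_continuous_on_def by metis
    have "dist (F t) (F s) < e" if "s \<in> {0<..b}" "t \<in> {0<..b}" "dist t s < d" for s t
    proof -
      have "dist (F t) (F s) \<le> dist (G t) (G s)"
        using diff[of s t] diff[of t s] that
        by (cases "s \<le> t") (auto simp: dist_norm norm_minus_commute abs_minus_commute)
      also have "\<dots> < e" using d(2)[of s t] that by auto
      finally show ?thesis .
    qed
    then show "\<exists>d>0. \<forall>x\<in>{0<..b}. \<forall>x'\<in>{0<..b}. dist x' x < d \<longrightarrow> dist (F x') (F x) < e"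
      using d(1) by blast
  qed
  then obtain H where H: "uniformly_continuous_on (closure {0<..b}) H" "\<And>s. s \<in> {0<..b} \<Longrightarrow> F s = H s"
    using uniformly_continuous_on_extension_on_closure by metis
  have contH: "continuous_on {0..b} H"
    using uniformly_continuous_imp_continuous[OF H(1)] b by simp
  have dF: "(H has_vector_derivative - f x) (at x)" if "x \<in> {0<..<b}" for x
  proof -
    have x: "x > 0" "x < b" using that by auto
    have "((\<lambda>u. integral {x/2..u} f) has_vector_derivative f x) (at x within {x/2..b})"
      using x by (intro integral_has_vector_derivative cont') auto
    then have "((\<lambda>u. integral {x/2..u} f) has_vector_derivative f x) (at x within {x/2<..<b})"
      by (rule has_vector_derivative_within_subset) auto
    then have "((\<lambda>u. integral {x/2..u} f) has_vector_derivative f x) (at x)"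
      using x by (subst (asm) has_vector_derivative_within_open) auto
    then have "((\<lambda>u. F (x/2) - integral {x/2..u} f) has_vector_derivative - f x) (at x)"
      by (auto intro!: derivative_eq_intros)
    moreover have "F (x/2) - integral {x/2..u} f = H u" if "u \<in> {x/2<..<b}" for u
    proof -
      have "F (x/2) - integral {x/2..u} f = F u"
        unfolding F_def using Henstock_Kurzweil_Integration.integral_combine[where a="x/2" and c=u and b=b and f=f] that x
          integrable_continuous_real[OF cont'[of "x/2" b]] by (simp add: algebra_simps)
      then show ?thesis using H(2)[of u] that x by auto
    qed
    ultimately show ?thesis
      using x by (elim has_vector_derivative_transform_within_open[where S="{x/2<..<b}"]) auto
  qed
  have "((\<lambda>x. - f x) has_integral (H b - H 0)) {0..b}"
    using b dF contH by (intro fundamental_theorem_of_calculus_interior) auto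
  then have "(f has_integral (- (H b - H 0))) {0..b}"
    by (auto dest: has_integral_neg)
  then have "(f has_integral (- (H b - H 0))) {0<..b}"
    by (rule has_integral_Icc_imp_Ioc)
  then show int: "f integrable_on {0<..b}" by blast
  have p: "((\<lambda>s. p * s powr (- a)) has_integral p * (b powr (1 - a) / (1 - a))) {0<..b}"
  proof (rule has_integral_Icc_imp_Ioc)
    show "((\<lambda>s. p * s powr (- a)) has_integral p * (b powr (1 - a) / (1 - a))) {0..b}"
      using has_integral_mult_right[OF has_integral_powr_from_0[of "-a" b], of p] a b by simp
  qed
  show "norm (integral {0<..b} f) \<le> p * (b powr (1 - a) / (1 - a))"
    using integral_norm_bound_integral[OF int has_integral_integrable[OF p]] le
    unfolding integral_unique[OF p] by simp
qed

text \<open>The majorant makes the integrals over \<open>{s..t}\<close> small uniformly in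
  \<open>t\<close> as \<open>s\<close> grows, which is the Cauchy criterion on the
  half-line.\<close>

lemma integrable_near_infinity:
  fixes f :: "real \<Rightarrow> 'b::banach"
  assumes a: "0 < a" and b: "0 < b" and cont: "continuous_on {b..} f"
    and le: "\<And>s. b \<le> s \<Longrightarrow> norm (f s) \<le> q * s powr (- a - 1)"
  shows "f integrable_on {b..}" "norm (integral {b..} f) \<le> q * (b powr (- a) / a)"
proof -
  have q: "q \<ge> 0" using order_trans[OF norm_ge_zero le[of b]] b by (simp add: zero_le_mult_iff)
  have G: "((\<lambda>s. q * s powr (- a - 1)) has_integral q * (s powr (-a) / a)) {s..}" if "0 < s" for s
    using has_integral_mult_right[OF has_integral_powr_to_inf[of "-a-1" s], of q] a that by simp
  have cont': "continuous_on {s..t} f" if "b \<le> s" for s t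
    using continuous_on_subset[OF cont] that by auto
  have norm_tail: "norm (integral {s..t} f) \<le> q * (s powr (-a) / a)" if "b \<le> s" for s t
  proof -
    have "norm (integral {s..t} f) \<le> integral {s..t} (\<lambda>s. q * s powr (- a - 1))"
      using that b by (intro integral_norm_bound_integral integrable_continuous_real cont' le
          continuous_intros) auto
    also have "\<dots> \<le> integral {s..} (\<lambda>s. q * s powr (- a - 1))"
      using G[of s] that b q
      by (intro integral_subset_le integrable_continuous_real continuous_intros) auto
    also have "\<dots> = q * (s powr (-a) / a)" using that b by (intro integral_unique G) auto
    finally show ?thesis .
  qed
  let ?g = "\<lambda>x. if x \<in> {b..} then f x else 0"
  have g: "integral {u..v} ?g = integral {b..v} f" if "u \<le> b" for u v
  proof -
    have "{u..v} \<inter> {b..} = {b..v}" using that by auto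
    then show ?thesis using integral_restrict_Int[of "{u..v}" "{b..}" f] by (simp only: Int_commute)
  qed
  show int: "f integrable_on {b..}"
  proof (rule integrable_alt_subset[THEN iffD2], intro conjI allI impI)
    fix u v :: real
    have "{b..} \<inter> {u..v} = {max u b..v}" by force
    moreover have "f integrable_on {max u b..v}"
      by (intro integrable_continuous_real cont') simp
    ultimately have "f integrable_on ({b..} \<inter> {u..v})" by (simp only:)
    then show "?g integrable_on cbox u v"
      using integrable_restrict_Int[of "{b..}" f "{u..v}"] by (simp only: cbox_interval)
  next
    fix e :: real assume e: "e > 0"
    have "((\<lambda>s. q * (s powr (-a) / a)) \<longlongrightarrow> q * (0 / a)) at_top"
      using a by (intro tendsto_intros tendsto_neg_powr filterlim_ident) auto
    then have "eventually (\<lambda>s. q * (s powr (-a) / a) < e) at_top"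
      using e by (intro order_tendstoD) auto
    then obtain B0 where B0: "\<And>s. s \<ge> B0 \<Longrightarrow> q * (s powr (-a) / a) < e"
      unfolding eventually_at_top_linorder by auto
    \<comment> \<open>A box around \<open>ball 0 (B + 1)\<close> has its left end below
      \<open>b\<close>, where \<open>?g\<close> vanishes, so two nested boxes differ only by a tail
      beyond \<open>B\<close>. The extra 1 puts \<open>B\<close> itself into the open ball.\<close>
    define B where "B = max b B0"
    have "norm (integral (cbox u v) ?g - integral (cbox u' v') ?g) < e"
      if "ball 0 (B + 1) \<subseteq> cbox u v" "cbox u v \<subseteq> cbox u' v'" for u v u' v'
    proof -
      have "B \<in> ball 0 (B + 1)" "0 \<in> ball 0 (B + 1)" using b by (auto simp: B_def dist_norm)
      then have "B \<in> {u..v}" "0 \<in> {u..v}" using that(1) by (auto simp only: cbox_interval)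
      then have u: "u \<le> 0" "B \<le> v" by auto
      then have B: "B > 0" "u \<le> v" using b by (auto simp: B_def)
      then have u': "u' \<le> u" "v \<le> v'" using that(2) by auto
      have "integral {b..v} f + integral {v..v'} f = integral {b..v'} f"
        using u u' b B by (intro Henstock_Kurzweil_Integration.integral_combine integrable_continuous_real cont') (auto simp: B_def)
      then have "integral (cbox u v) ?g - integral (cbox u' v') ?g = - integral {v..v'} f"
        using g[of u v] g[of u' v'] u u' b by (simp add: algebra_simps)
      then have "norm (integral (cbox u v) ?g - integral (cbox u' v') ?g) \<le> q * (v powr (-a) / a)"
        using norm_tail[of v v'] u by (simp add: B_def)
      also have "\<dots> < e" using B0[of v] u by (simp add: B_def)
      finally show ?thesis .
    qed
    moreover have "B + 1 > 0" using b by (simp add: B_def)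
    ultimately show "\<exists>B>0. \<forall>u v u' v'. ball 0 B \<subseteq> cbox u v \<and> cbox u v \<subseteq> cbox u' v' \<longrightarrow>
        norm (integral (cbox u v) ?g - integral (cbox u' v') ?g) < e"
      by blast
  qed
  show "norm (integral {b..} f) \<le> q * (b powr (- a) / a)"
    using integral_norm_bound_integral[OF int has_integral_integrable[OF G[OF b]]] le
    unfolding integral_unique[OF G[OF b]] by simp
qed

text \<open>The linear bound serves near 0, the constant one near infinity. The cut
  \<open>\<tau>\<close> stays free: it is 1 where any finite bound will do, \<open>t\<close> for
  Cesaro means, and large for approximate eigenvectors.\<close>

lemma powr_weight_integral:
  fixes f :: "real \<Rightarrow> 'b::banach"
  assumes a: "0 < a" "a < 1" and \<tau>: "0 < \<tau>" and cont: "continuous_on {0<..} f"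
    and p: "\<And>s. 0 < s \<Longrightarrow> norm (f s) \<le> p * s" and q: "\<And>s. 0 < s \<Longrightarrow> norm (f s) \<le> q"
  shows "(\<lambda>s. s powr (- a - 1) *\<^sub>R f s) integrable_on {0<..}"
    and "norm (integral {0<..} (\<lambda>s. s powr (- a - 1) *\<^sub>R f s))
           \<le> p * (\<tau> powr (1 - a) / (1 - a)) + q * (\<tau> powr (- a) / a)"
proof -
  let ?f = "\<lambda>s. s powr (- a - 1) *\<^sub>R f s"
  have c: "continuous_on {0<..} ?f" by (intro continuous_intros cont) auto
  have p': "norm (?f s) \<le> p * s powr (- a)" if "0 < s" "s \<le> \<tau>" for s
  proof -
    have "norm (?f s) \<le> s powr (-a - 1) * (p * s)"
      using p[of s] that by (simp add: mult_left_mono)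
    also have "\<dots> = p * s powr (-a)" using that by (simp add: powr_diff)
    finally show ?thesis .
  qed
  have q': "norm (?f s) \<le> q * s powr (- a - 1)" if "\<tau> \<le> s" for s
    using q[of s] that \<tau> by (simp add: mult.commute mult_left_mono)
  have sub: "{0<..\<tau>} \<subseteq> {0<..}" "{\<tau>..} \<subseteq> {0<..}" using \<tau> by auto
  note 1 = integrable_near_0[OF a(2) \<tau> continuous_on_subset[OF c sub(1)] p']
  note 2 = integrable_near_infinity[OF a(1) \<tau> continuous_on_subset[OF c sub(2)] q']
  have un: "{0<..\<tau>} \<union> {\<tau>..} = {0<..}" using \<tau> by auto
  have "{0<..\<tau>} \<inter> {\<tau>..} = {\<tau>}" using \<tau> by auto
  then have I: "(?f has_integral (integral {0<..\<tau>} ?f + integral {\<tau>..} ?f)) {0<..}"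
    unfolding un[symmetric] using 1(1) 2(1) by (intro has_integral_Un) auto
  then show "?f integrable_on {0<..}" by blast
  show "norm (integral {0<..} ?f)
           \<le> p * (\<tau> powr (1 - a) / (1 - a)) + q * (\<tau> powr (- a) / a)"
    using integral_unique[OF I] 1(2) 2(2)
    by (metis (no_types, lifting) add_mono norm_triangle_le)
qed

section \<open>Orbits of a bounded semigroup\<close>

lemma has_vector_derivative_norm_diff_le:
  fixes f :: "real \<Rightarrow> 'b::real_normed_vector"
  assumes "0 \<le> t" "\<And>u. u \<in> {0..t} \<Longrightarrow> (f has_vector_derivative f' u) (at u within {0..t})"
    and "\<And>u. u \<in> {0..t} \<Longrightarrow> norm (f' u) \<le> B"
  shows "norm (f t - f 0) \<le> B * t"
proof -
  have "norm (f t - f 0) \<le> B * norm (t - 0)"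
  proof (rule differentiable_bound[of "{0..t}" f "\<lambda>u h. h *\<^sub>R f' u"])
    fix u assume u: "u \<in> {0..t}"
    show "(f has_derivative (\<lambda>h. h *\<^sub>R f' u)) (at u within {0..t})"
      using assms(2)[OF u] unfolding has_vector_derivative_def .
    show "onorm (\<lambda>h. h *\<^sub>R f' u) \<le> B"
      using mult_left_mono[OF assms(3)[OF u]] by (intro onorm_le) (simp add: mult.commute[of B])
  qed (use assms(1) in auto)
  then show ?thesis using assms(1) by simp
qed

text \<open>\<open>1 \<le> M\<close> lets \<open>norm x\<close> be absorbed into
  \<open>M * norm x\<close> and keeps \<open>ln (2 * M)\<close> nonnegative.\<close>

locale bounded_semigroup =
  fixes J :: "'a::banach \<Rightarrow> 'a" and T :: "real \<Rightarrow> 'a \<Rightarrow> 'a" and M :: real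
  assumes J: "complex_structure J"
    and T: "bounded_C0_semigroup J T"
    and M: "1 \<le> M" "\<And>t x. 0 \<le> t \<Longrightarrow> norm (T t x) \<le> M * norm x"
begin

lemma T_lin: "0 \<le> t \<Longrightarrow> bounded_linear (T t)"
  and T_J: "0 \<le> t \<Longrightarrow> T t (J x) = J (T t x)"
  and T_0 [simp]: "T 0 x = x"
  and T_add: "0 \<le> s \<Longrightarrow> 0 \<le> t \<Longrightarrow> T (s + t) x = T s (T t x)"
  and T_cont: "continuous_on {0..} (\<lambda>t. T t x)"
  using T unfolding bounded_C0_semigroup_def by auto

lemma M_ge_0: "0 \<le> M" using M(1) by simp

lemma J_lin: "bounded_linear J" and J_J [simp]: "J (J x) = - x"
  using J unfolding complex_structure_def by auto

lemma J_linear [simp]: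
  "J (x + y) = J x + J y" "J (x - y) = J x - J y" "J (c *\<^sub>R x) = c *\<^sub>R J x" "J (- x) = - J x" "J 0 = 0"
  using J_lin[THEN bounded_linear.linear]
  by (simp_all add: linear_add linear_diff linear_scale linear_neg linear_0)

lemma T_linear [simp]:
  assumes "0 \<le> t"
  shows "T t (x + y) = T t x + T t y" "T t (x - y) = T t x - T t y" "T t (c *\<^sub>R x) = c *\<^sub>R T t x"
    "T t (- x) = - T t x" "T t 0 = 0"
  using T_lin[OF assms, THEN bounded_linear.linear]
  by (simp_all add: linear_add linear_diff linear_scale linear_neg linear_0)

lemma norm_cscale [simp]: "norm (cscale J c x) = cmod c * norm x"
  using J unfolding complex_structure_def cscale_def by (metis complex_surj)

lemma T_cscale: "0 \<le> t \<Longrightarrow> T t (cscale J c x) = cscale J c (T t x)"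
  unfolding cscale_def by (simp add: T_J)

lemma cscale_cscale: "cscale J c (cscale J d x) = cscale J (c * d) x"
  unfolding cscale_def by (simp add: algebra_simps)

lemma cscale_one [simp]: "cscale J 1 x = x"
  and cscale_of_real: "cscale J (of_real r) x = r *\<^sub>R x"
  unfolding cscale_def by auto

lemma bounded_bilinear_cscale: "bounded_bilinear (cscale J)"
proof
  show "\<exists>K. \<forall>a b. norm (cscale J a b) \<le> norm a * norm b * K"
    by (intro exI[of _ 1]) simp
qed (auto simp: cscale_def algebra_simps)

sublocale cscale: bounded_bilinear "cscale J"
  by (rule bounded_bilinear_cscale)

lemma T_commute: "0 \<le> s \<Longrightarrow> 0 \<le> t \<Longrightarrow> T s (T t x) = T t (T s x)"
  by (metis T_add add.commute)

section \<open>The generator and operators commuting with the semigroup\<close>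

lemma neg_gen_rel_unique: "neg_gen_rel T x y \<Longrightarrow> neg_gen_rel T x z \<Longrightarrow> y = z"
  unfolding neg_gen_rel_def by (rule tendsto_unique) auto

lemma opA_eqI: "neg_gen_rel T x y \<Longrightarrow> x \<in> opA_dom T \<and> opA T x = - y"
  unfolding opA_dom_def opA_def using neg_gen_rel_unique by (auto intro!: the_equality)

lemma neg_gen_rel_opA: "x \<in> opA_dom T \<Longrightarrow> neg_gen_rel T x (- opA T x)"
  using opA_eqI unfolding opA_dom_def by force

lemma neg_gen_rel_lincomb:
  assumes "neg_gen_rel T x y" "neg_gen_rel T x' y'"
  shows "neg_gen_rel T (a *\<^sub>R x + b *\<^sub>R x') (a *\<^sub>R y + b *\<^sub>R y')"
proof -
  have "((\<lambda>h. a *\<^sub>R (inverse h *\<^sub>R (T h x - x)) + b *\<^sub>R (inverse h *\<^sub>R (T h x' - x')))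
      \<longlongrightarrow> a *\<^sub>R y + b *\<^sub>R y') (at_right 0)"
    using assms unfolding neg_gen_rel_def by (intro tendsto_intros)
  then show ?thesis unfolding neg_gen_rel_def
  proof (rule Lim_transform_eventually)
    have "a *\<^sub>R (inverse h *\<^sub>R (T h x - x)) + b *\<^sub>R (inverse h *\<^sub>R (T h x' - x'))
        = inverse h *\<^sub>R (T h (a *\<^sub>R x + b *\<^sub>R x') - (a *\<^sub>R x + b *\<^sub>R x'))" if "h > 0" for h
      using that by (simp add: scaleR_add_right scaleR_diff_right mult.commute)
    then show "eventually (\<lambda>h. a *\<^sub>R (inverse h *\<^sub>R (T h x - x)) + b *\<^sub>R (inverse h *\<^sub>R (T h x' - x'))
        = inverse h *\<^sub>R (T h (a *\<^sub>R x + b *\<^sub>R x') - (a *\<^sub>R x + b *\<^sub>R x'))) (at_right 0)"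
      by (auto simp: eventually_at_filter)
  qed
qed

text \<open>A bounded operator passes through the limit of difference quotients. The instances are
  \<open>L = J\<close>, which makes A complex linear, and \<open>L = T t\<close>, which makes its
  domain invariant.\<close>

lemma neg_gen_rel_bounded_linear:
  assumes "bounded_linear L" "\<And>t x. 0 \<le> t \<Longrightarrow> L (T t x) = T t (L x)" "neg_gen_rel T x y"
  shows "neg_gen_rel T (L x) (L y)"
proof -
  have "((\<lambda>h. L (inverse h *\<^sub>R (T h x - x))) \<longlongrightarrow> L y) (at_right 0)"
    by (rule bounded_linear.tendsto[OF assms(1) assms(3)[unfolded neg_gen_rel_def]])
  then show ?thesis unfolding neg_gen_rel_def
  proof (rule Lim_transform_eventually)
    have "linear L" using assms(1) by (rule bounded_linear.linear)
    then have "L (inverse h *\<^sub>R (T h x - x)) = inverse h *\<^sub>R (T h (L x) - L x)" if "h > 0" for h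
      using that assms(2)[of h x] by (simp add: linear_scale linear_diff)
    then show "eventually (\<lambda>h. L (inverse h *\<^sub>R (T h x - x)) = inverse h *\<^sub>R (T h (L x) - L x)) (at_right 0)"
      by (auto simp: eventually_at_filter)
  qed
qed

lemma opA_lincomb:
  assumes "x \<in> opA_dom T" "x' \<in> opA_dom T"
  shows "a *\<^sub>R x + b *\<^sub>R x' \<in> opA_dom T"
    "opA T (a *\<^sub>R x + b *\<^sub>R x') = a *\<^sub>R opA T x + b *\<^sub>R opA T x'"
  using opA_eqI[OF neg_gen_rel_lincomb[OF assms[THEN neg_gen_rel_opA], of a b]] by auto

lemma opA_J:
  assumes "x \<in> opA_dom T" shows "J x \<in> opA_dom T" "opA T (J x) = J (opA T x)"
  using opA_eqI[OF neg_gen_rel_bounded_linear[OF J_lin T_J[symmetric] neg_gen_rel_opA[OF assms]]]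
  by simp_all

lemma opA_T:
  assumes "x \<in> opA_dom T" "0 \<le> t" shows "T t x \<in> opA_dom T"
  using opA_eqI[OF neg_gen_rel_bounded_linear[OF T_lin[OF assms(2)] _ neg_gen_rel_opA[OF assms(1)]]]
    T_commute[OF assms(2)] by blast

lemma opA_dom_subspace: "subspace (opA_dom T)"
proof -
  have "neg_gen_rel T 0 0" unfolding neg_gen_rel_def
    by (rule Lim_transform_eventually[OF tendsto_const]) (auto simp: eventually_at_filter)
  then have "0 \<in> opA_dom T" using opA_eqI by blast
  then show ?thesis
    using opA_lincomb(1)[of _ _ 1 1] opA_lincomb(1)[of _ 0 _ 0] by (auto simp: subspace_def)
qed

lemma opA_cscale:
  assumes "x \<in> opA_dom T" shows "cscale J c x \<in> opA_dom T" "opA T (cscale J c x) = cscale J c (opA T x)"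
  using opA_lincomb[OF assms opA_J(1)[OF assms], of "Re c" "Im c"] opA_J(2)[OF assms]
  by (auto simp: cscale_def)

text \<open>The generator gives only a right derivative at 0. For \<open>v\<close> on either side of
  \<open>u\<close> the earlier of the two times is factored out as \<open>T m\<close>, and
  \<open>T m z\<close> is compared with \<open>T u ?y\<close> by uniform boundedness and strong
  continuity at \<open>u\<close>.\<close>

lemma orbit_has_vector_derivative:
  assumes x: "x \<in> opA_dom T" and u: "0 \<le> u"
  shows "((\<lambda>t. T t x) has_vector_derivative - T u (opA T x)) (at u within {0..})"
  unfolding has_vector_derivative_def has_derivative_within_alt
proof (intro conjI allI impI)
  let ?y = "- opA T x"
  fix e :: real assume e: "e > 0"
  define e' where "e' = e / (M + 1)"
  have e': "e' > 0" "(M + 1) * e' = e" using e M by (auto simp: e'_def)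
  have "((\<lambda>h. inverse h *\<^sub>R (T h x - x)) \<longlongrightarrow> ?y) (at_right 0)"
    using neg_gen_rel_opA[OF x] unfolding neg_gen_rel_def .
  then have "eventually (\<lambda>h. dist (inverse h *\<^sub>R (T h x - x)) ?y < e') (at_right 0)"
    using e'(1) by (rule tendstoD)
  then obtain d1 where d1: "d1 > 0" "\<And>h. 0 < h \<Longrightarrow> h < d1 \<Longrightarrow> dist (inverse h *\<^sub>R (T h x - x)) ?y < e'"
    unfolding eventually_at_right_field by auto
  from T_cont[of ?y] u obtain d2 where d2: "d2 > 0"
    "\<And>m. m \<in> {0..} \<Longrightarrow> dist m u < d2 \<Longrightarrow> dist (T m ?y) (T u ?y) < e'"
    unfolding continuous_on_iff using e'(1) by (metis atLeast_iff)
  have "norm (T v x - T u x - (v - u) *\<^sub>R - T u (opA T x)) \<le> e * norm (v - u)"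
    if v: "v \<in> {0..}" "norm (v - u) < min d1 d2" for v
  proof (cases "v = u")
    case False
    define h m where "h = \<bar>v - u\<bar>" and "m = min u v"
    define z where "z = inverse h *\<^sub>R (T h x - x)"
    have h: "0 < h" "h < d1" "h < d2" and m: "0 \<le> m" "\<bar>m - u\<bar> < d2"
      using v u False by (auto simp: h_def m_def)
    have 1: "norm (z - ?y) \<le> e'" using d1(2)[of h] h by (simp add: z_def dist_norm)
    have 2: "norm (T m ?y - T u ?y) \<le> e'"
      using d2(2)[of m] m by (simp add: dist_norm)
    have hz: "h *\<^sub>R z = T h x - x" using h by (simp add: z_def)
    have mh: "T (m + h) x - T m x = h *\<^sub>R T m z"
      using T_add[of m h x] m h hz by (metis T_linear(2,3) less_eq_real_def)
    have "T m z - T u ?y = T m (z - ?y) + (T m ?y - T u ?y)"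
      using m u by simp
    also have "norm \<dots> \<le> M * e' + e'"
      using M(2)[OF m(1), of "z - ?y"] 1 2 M_ge_0
      by (intro norm_triangle_le add_mono) (auto intro: order_trans mult_left_mono)
    finally have "norm (T m z - T u ?y) \<le> e" using e'(2) by (simp add: algebra_simps)
    moreover have "norm (T v x - T u x - (v - u) *\<^sub>R T u ?y) = h * norm (T m z - T u ?y)"
    proof (cases "u < v")
      case True
      then have eq: "m = u" "m + h = v" "v - u = h" by (auto simp: h_def m_def)
      then have "T v x - T u x - (v - u) *\<^sub>R T u ?y = h *\<^sub>R (T m z - T u ?y)"
        using mh by (simp only: scaleR_diff_right)
      then show ?thesis using h by simp
    next
      case False
      then have eq: "m = v" "m + h = u" "v - u = - h" by (auto simp: h_def m_def)
      then have "T v x - T u x = - h *\<^sub>R T m z"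
        using mh by (metis minus_diff_eq scaleR_minus_left)
      then have "T v x - T u x - (v - u) *\<^sub>R T u ?y = - (h *\<^sub>R (T m z - T u ?y))"
        unfolding eq(3) by (simp only: scaleR_diff_right scaleR_minus_left minus_diff_eq) (simp only: diff_conv_add_uminus minus_add_distrib minus_minus add.commute)
      then show ?thesis using h by (simp only: norm_minus_cancel norm_scaleR abs_of_pos)
    qed
    ultimately show ?thesis using h u by (simp add: h_def mult.commute mult_left_mono)
  qed simp
  then show "\<exists>d>0. \<forall>v\<in>{0..}. norm (v - u) < d \<longrightarrow>
      norm (T v x - T u x - (v - u) *\<^sub>R - T u (opA T x)) \<le> e * norm (v - u)"
    using d1(1) d2(1) by (intro exI[of _ "min d1 d2"]) auto
qed (rule bounded_linear_scaleR_left)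

text \<open>The product rule merges the scalar factor and A into the defect zx - Ax, which is small
  for an approximate eigenvector.\<close>

lemma twisted_orbit_has_vector_derivative:
  assumes x: "x \<in> opA_dom T" and u: "u \<in> {0..s}"
  shows "((\<lambda>u. cscale J (exp (z * of_real (u - a))) (T u x)) has_vector_derivative
      cscale J (exp (z * of_real (u - a))) (T u (cscale J z x - opA T x))) (at u within {0..s})"
proof -
  let ?e = "exp (z * of_real (u - a))"
  have "((\<lambda>w. exp (z * (w - of_real a))) has_field_derivative exp (z * (of_real u - of_real a)) * z)
      (at (of_real u))"
    by (auto intro!: derivative_eq_intros)
  from has_vector_derivative_real_field[OF this]
  have "((\<lambda>u. exp (z * of_real (u - a))) has_vector_derivative ?e * z) (at u within {0..s})"
    by simp
  moreover have "((\<lambda>t. T t x) has_vector_derivative - T u (opA T x)) (at u within {0..s})"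
    using u by (intro has_vector_derivative_within_subset[OF orbit_has_vector_derivative[OF x]]) auto
  ultimately have "((\<lambda>u. cscale J (exp (z * of_real (u - a))) (T u x)) has_vector_derivative
      cscale J ?e (- T u (opA T x)) + cscale J (?e * z) (T u x)) (at u within {0..s})"
    by (rule cscale.has_vector_derivative)
  moreover have "cscale J ?e (- T u (opA T x)) + cscale J (?e * z) (T u x)
      = cscale J ?e (T u (cscale J z x - opA T x))"
    using u by (simp add: cscale.minus_right cscale.diff_right T_cscale cscale_cscale)
  ultimately show ?thesis by simp
qed

text \<open>The offset \<open>a\<close> normalizes the exponential to modulus at most 1 on
  \<open>{0..s}\<close>: it is \<open>s\<close> when \<open>0 \<le> Re z\<close>, and 0 when
  \<open>Re z < 0\<close>.\<close>

lemma twisted_orbit_diff_le: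
  assumes x: "x \<in> opA_dom T" and s: "0 \<le> s" and a: "\<And>u. u \<in> {0..s} \<Longrightarrow> Re z * (u - a) \<le> 0"
  shows "norm (cscale J (exp (z * of_real (s - a))) (T s x) - cscale J (exp (- (z * of_real a))) x)
      \<le> M * norm (opA T x - cscale J z x) * s"
proof -
  have "norm (cscale J (exp (z * of_real (u - a))) (T u (cscale J z x - opA T x)))
      \<le> M * norm (opA T x - cscale J z x)" if u: "u \<in> {0..s}" for u
  proof -
    have "cmod (exp (z * of_real (u - a))) \<le> 1" using a[OF u] by simp
    then have "norm (cscale J (exp (z * of_real (u - a))) (T u (cscale J z x - opA T x)))
        \<le> norm (T u (cscale J z x - opA T x))"
      unfolding norm_cscale by (intro mult_left_le_one_le) auto
    also have "\<dots> \<le> M * norm (opA T x - cscale J z x)"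
      using M(2)[of u "cscale J z x - opA T x"] u by (simp add: norm_minus_commute)
    finally show ?thesis .
  qed
  from has_vector_derivative_norm_diff_le[OF s twisted_orbit_has_vector_derivative[OF x] this]
  show ?thesis by simp
qed

text \<open>An approximate eigenvector of A is thus one of every \<open>T s\<close>, and the factor
  \<open>s\<close> in the error tames the singular weight at 0. For \<open>z = 0\<close> this is a
  Lipschitz bound for the orbit.\<close>

lemma T_diff_cscale_exp_le:
  assumes x: "x \<in> opA_dom T" and z: "0 \<le> Re z" and s: "0 \<le> s"
  shows "norm (T s x - cscale J (exp (- (z * of_real s))) x) \<le> M * norm (opA T x - cscale J z x) * s"
  using twisted_orbit_diff_le[OF x s, of z s] z by (simp add: mult_le_0_iff)

lemma norm_diff_T_le:
  assumes "x \<in> opA_dom T" "0 \<le> s"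
  shows "norm (x - T s x) \<le> M * norm (opA T x) * s"
  using T_diff_cscale_exp_le[OF assms(1), of 0 s] assms(2) by (simp add: norm_minus_commute cscale.zero_left)

lemma norm_diff_T_le': "0 \<le> s \<Longrightarrow> norm (x - T s x) \<le> 2 * M * norm x"
  using M(2)[of s x] mult_right_mono[OF M(1), of "norm x"] by (intro norm_triangle_le_diff) auto

lemma opA_ker_T: "u \<in> opA_ker T \<Longrightarrow> 0 \<le> s \<Longrightarrow> T s u = u"
  using norm_diff_T_le[of u s] by (simp add: opA_ker_def)

end

section \<open>Fractional powers and Cesaro means\<close>

locale fractional_semigroup = bounded_semigroup +
  fixes \<alpha> :: real
  assumes \<alpha>: "0 < \<alpha>" "\<alpha> < 1"
begin

lemma T_cont': "A \<subseteq> {0..} \<Longrightarrow> continuous_on A (\<lambda>t. T t x)"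
  using T_cont continuous_on_subset by blast

lemma T_integrable: "0 \<le> s \<Longrightarrow> (\<lambda>t. T t x) integrable_on {s..t}"
  by (intro integrable_continuous_real T_cont') auto

definition "\<gamma> = \<alpha> / Gamma (1 - \<alpha>)"

lemma \<gamma>_pos: "0 < \<gamma>"
  using \<alpha> unfolding \<gamma>_def by (simp add: Gamma_real_pos)

section \<open>Cesaro means as bounded operators\<close>

lemma cesaro_add: "cesaro T t (x + y) = cesaro T t x + cesaro T t y"
proof -
  have "integral {0..t} (\<lambda>s. T s (x + y)) = integral {0..t} (\<lambda>s. T s x + T s y)"
    by (intro integral_cong) auto
  then show ?thesis
    unfolding cesaro_def by (simp add: integral_add T_integrable scaleR_add_right)
qed

lemma cesaro_scaleR: "cesaro T t (r *\<^sub>R x) = r *\<^sub>R cesaro T t x"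
proof -
  have "integral {0..t} (\<lambda>s. T s (r *\<^sub>R x)) = integral {0..t} (\<lambda>s. r *\<^sub>R T s x)"
    by (intro integral_cong) auto
  then show ?thesis unfolding cesaro_def by simp
qed

lemma cesaro_norm_le:
  assumes "0 < t" shows "norm (cesaro T t x) \<le> M * norm x"
proof -
  have "norm (integral {0..t} (\<lambda>s. T s x)) \<le> (M * norm x) * (t - 0)"
    using assms by (intro integral_bound T_cont' M) auto
  then show ?thesis using assms unfolding cesaro_def by (simp add: divide_simps mult.commute)
qed

lemma cesaro_bounded_linear: "0 < t \<Longrightarrow> bounded_linear (cesaro T t)"
  by (rule bounded_linear_intro[where K=M])
     (auto simp: cesaro_add cesaro_scaleR cesaro_norm_le mult.commute)

text \<open>After a shift of variable the common part of the two integrals cancels, and two pieces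
  of length \<open>s\<close> remain, each at most \<open>M * norm x * s\<close>. The identity also
  holds for \<open>s\<close> larger than \<open>t\<close>.\<close>

lemma cesaro_orbit_diff_le:
  assumes t: "0 < t" and s: "0 \<le> s"
  shows "norm (cesaro T t (x - T s x)) \<le> 2 * M * norm x / t * s"
proof -
  let ?I = "\<lambda>a b. integral {a..b} (\<lambda>u. T u x)"
  have "integral {0..t} (\<lambda>u. T u (x - T s x)) = integral {0..t} (\<lambda>u. T u x - T (u + s) x)"
    using s by (intro integral_cong) (auto simp: T_add)
  also have "\<dots> = ?I 0 t - integral {0..t} (\<lambda>u. T (u + s) x)"
    using s by (intro integral_diff T_integrable order_refl integrable_continuous_real
        continuous_on_compose2[OF T_cont[of x]] continuous_intros) auto
  also have "integral {0..t} (\<lambda>u. T (u + s) x) = ?I s (t + s)"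
    using integral_shift_real_ivl[of s s "t + s" "\<lambda>u. T u x"] by simp
  also have "?I 0 t - ?I s (t + s) = ?I 0 s - ?I t (t + s)"
  proof -
    have "?I 0 t + ?I t (t + s) = ?I 0 (t + s)" "?I 0 s + ?I s (t + s) = ?I 0 (t + s)"
      using s t by (auto intro!: Henstock_Kurzweil_Integration.integral_combine T_integrable)
    then have "?I 0 t = ?I 0 (t + s) - ?I t (t + s)" "?I s (t + s) = ?I 0 (t + s) - ?I 0 s"
      by (simp_all only: eq_diff_eq add.commute)
    then show ?thesis by simp
  qed
  finally have eq: "integral {0..t} (\<lambda>u. T u (x - T s x)) = ?I 0 s - ?I t (t + s)" .
  have le: "norm (?I a b) \<le> (M * norm x) * (b - a)" if "0 \<le> a" "a \<le> b" for a b
    using that by (intro integral_bound T_cont' M) auto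
  have "norm (?I 0 s - ?I t (t + s)) \<le> norm (?I 0 s) + norm (?I t (t + s))" by (rule norm_triangle_ineq4)
  also have "\<dots> \<le> 2 * M * norm x * s" using le[of 0 s] le[of t "t + s"] s t by simp
  finally show ?thesis
    using t unfolding cesaro_def eq by (simp add: divide_simps)
qed

section \<open>The fractional power on the domain of A\<close>

lemma frac_pre_eq:
  "frac_pre T \<alpha> x = \<gamma> *\<^sub>R integral {0<..} (\<lambda>s. s powr (- \<alpha> - 1) *\<^sub>R (x - T s x))"
proof -
  have "frac_pre T \<alpha> x = integral {0<..} (\<lambda>s. \<gamma> *\<^sub>R (s powr (- \<alpha> - 1) *\<^sub>R (x - T s x)))"
    unfolding frac_pre_def \<gamma>_def by simp
  then show ?thesis by (simp only: integral_cmul)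
qed

lemma orbit_diff_continuous: "continuous_on {0<..} (\<lambda>s. x - T s x)"
  by (intro continuous_intros T_cont') auto

lemma frac_integrable:
  assumes "x \<in> opA_dom T"
  shows "(\<lambda>s. s powr (- \<alpha> - 1) *\<^sub>R (x - T s x)) integrable_on {0<..}"
  by (rule powr_weight_integral(1)[OF \<alpha> zero_less_one orbit_diff_continuous,
        where p="M * norm (opA T x)" and q="2 * M * norm x"])
     (use norm_diff_T_le[OF assms] norm_diff_T_le' in auto)

lemma frac_pre_norm_le:
  assumes "x \<in> opA_dom T"
  shows "norm (frac_pre T \<alpha> x) \<le> \<gamma> * (M * norm (opA T x) / (1 - \<alpha>) + 2 * M * norm x / \<alpha>)"
proof -
  have "norm (integral {0<..} (\<lambda>s. s powr (- \<alpha> - 1) *\<^sub>R (x - T s x)))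
      \<le> M * norm (opA T x) * (1 powr (1 - \<alpha>) / (1 - \<alpha>)) + 2 * M * norm x * (1 powr (- \<alpha>) / \<alpha>)"
    by (rule powr_weight_integral(2)[OF \<alpha> zero_less_one orbit_diff_continuous])
       (use norm_diff_T_le[OF assms] norm_diff_T_le' in auto)
  then show ?thesis using \<gamma>_pos by (simp add: frac_pre_eq)
qed

lemma frac_pre_lincomb:
  assumes "x \<in> opA_dom T" "y \<in> opA_dom T"
  shows "frac_pre T \<alpha> (a *\<^sub>R x + b *\<^sub>R y) = a *\<^sub>R frac_pre T \<alpha> x + b *\<^sub>R frac_pre T \<alpha> y"
proof -
  let ?w = "\<lambda>s. s powr (- \<alpha> - 1)"
  have "integral {0<..} (\<lambda>s. ?w s *\<^sub>R (a *\<^sub>R x + b *\<^sub>R y - T s (a *\<^sub>R x + b *\<^sub>R y)))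
      = integral {0<..} (\<lambda>s. a *\<^sub>R (?w s *\<^sub>R (x - T s x)) + b *\<^sub>R (?w s *\<^sub>R (y - T s y)))"
    by (intro integral_cong) (auto simp: algebra_simps)
  also have "\<dots> = a *\<^sub>R integral {0<..} (\<lambda>s. ?w s *\<^sub>R (x - T s x)) + b *\<^sub>R integral {0<..} (\<lambda>s. ?w s *\<^sub>R (y - T s y))"
    by (simp only: integral_add integrable_cmul frac_integrable assms integral_cmul)
  finally show ?thesis by (simp add: frac_pre_eq scaleR_add_right mult.commute)
qed

lemma bounded_linear_frac_pre:
  assumes "bounded_linear L" "x \<in> opA_dom T"
  shows "L (frac_pre T \<alpha> x) = \<gamma> *\<^sub>R integral {0<..} (\<lambda>s. s powr (- \<alpha> - 1) *\<^sub>R L (x - T s x))"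
proof -
  have lin: "linear L" using assms(1) by (rule bounded_linear.linear)
  have "L \<circ> (\<lambda>s. s powr (- \<alpha> - 1) *\<^sub>R (x - T s x)) = (\<lambda>s. s powr (- \<alpha> - 1) *\<^sub>R L (x - T s x))"
    by (simp only: o_def linear_scale[OF lin])
  then show ?thesis
    using integral_linear[OF frac_integrable[OF assms(2)] assms(1)]
    by (simp only: frac_pre_eq linear_scale[OF lin])
qed

text \<open>The two terms are what \<open>powr_weight_integral\<close> gives for the cut
  \<open>t\<close>: one from the slope \<open>2 * M * norm x / t\<close> of
  \<open>cesaro_orbit_diff_le\<close>, the other from the uniform bound
  \<open>2 * M\<^sup>2 * norm x\<close>.\<close>

definition "cesaro_const = \<gamma> * (2 * M / (1 - \<alpha>) + 2 * M\<^sup>2 / \<alpha>)"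

lemma cesaro_const_pos: "0 < cesaro_const"
  using \<alpha> \<gamma>_pos M(1) unfolding cesaro_const_def by (intro mult_pos_pos add_pos_pos divide_pos_pos) auto

lemma cesaro_frac_pre_le:
  assumes t: "0 < t" and x: "x \<in> opA_dom T"
  shows "norm (cesaro T t (frac_pre T \<alpha> x)) \<le> cesaro_const * t powr (- \<alpha>) * norm x"
proof -
  have le: "norm (cesaro T t (x - T s x)) \<le> 2 * M\<^sup>2 * norm x" if "0 < s" for s
  proof -
    have "norm (cesaro T t (x - T s x)) \<le> M * (2 * M * norm x)"
      using cesaro_norm_le[OF t, of "x - T s x"] norm_diff_T_le'[of s x] that M_ge_0
      by (meson less_imp_le mult_left_mono order_trans)
    then show ?thesis by (simp add: power2_eq_square mult_ac)
  qed
  have "norm (integral {0<..} (\<lambda>s. s powr (- \<alpha> - 1) *\<^sub>R cesaro T t (x - T s x)))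
      \<le> 2 * M * norm x / t * (t powr (1 - \<alpha>) / (1 - \<alpha>)) + 2 * M\<^sup>2 * norm x * (t powr (- \<alpha>) / \<alpha>)"
    by (rule powr_weight_integral(2)[OF \<alpha> t])
       (use cesaro_orbit_diff_le[OF t] le in
         \<open>auto intro: bounded_linear.continuous_on[OF cesaro_bounded_linear[OF t] orbit_diff_continuous]\<close>)
  also have "t powr (1 - \<alpha>) = t * t powr (- \<alpha>)" using t by (simp add: powr_diff powr_minus divide_simps)
  also have "2 * M * norm x / t * (t * t powr (- \<alpha>) / (1 - \<alpha>)) + 2 * M\<^sup>2 * norm x * (t powr (- \<alpha>) / \<alpha>)
      = (2 * M / (1 - \<alpha>) + 2 * M\<^sup>2 / \<alpha>) * (t powr (- \<alpha>) * norm x)"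
  proof -
    have "2 * M * norm x / t * (t * t powr (- \<alpha>) / (1 - \<alpha>)) = 2 * M / (1 - \<alpha>) * (t powr (- \<alpha>) * norm x)"
      using t by simp
    then show ?thesis by (simp only: distrib_right) simp
  qed
  finally show ?thesis
    using \<gamma>_pos unfolding bounded_linear_frac_pre[OF cesaro_bounded_linear[OF t] x] cesaro_const_def
    by (simp add: mult.assoc)
qed

text \<open>For fixed \<open>w\<close> the inequality is a closed condition on
  \<open>(x, y)\<close>, so it passes from the core to the closure. With \<open>w = 0\<close> it
  gives the rate; with \<open>w\<close> near \<open>x\<close> it bounds the remainder of an
  approximation.\<close>

lemma cesaro_frac_graph_le:
  assumes t: "0 < t" and xy: "(x, y) \<in> frac_graph T \<alpha>" and w: "w \<in> opA_dom T"
  shows "norm (cesaro T t (y - frac_pre T \<alpha> w)) \<le> cesaro_const * t powr (- \<alpha>) * norm (x - w)"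
proof -
  let ?S = "{p. norm (cesaro T t (snd p - frac_pre T \<alpha> w)) \<le> cesaro_const * t powr (- \<alpha>) * norm (fst p - w)}"
  have "{(x, frac_pre T \<alpha> x) |x. x \<in> opA_dom T} \<subseteq> ?S"
  proof clarsimp
    fix x assume x: "x \<in> opA_dom T"
    show "norm (cesaro T t (frac_pre T \<alpha> x - frac_pre T \<alpha> w)) \<le> cesaro_const * t powr (- \<alpha>) * norm (x - w)"
      using cesaro_frac_pre_le[OF t subspace_diff[OF opA_dom_subspace x w]]
        frac_pre_lincomb[OF x w, of 1 "-1"] by simp
  qed
  moreover have "closed ?S"
  proof (rule closed_Collect_le)
    have "continuous_on UNIV (\<lambda>p :: 'a \<times> 'a. snd p - frac_pre T \<alpha> w)"
      by (intro continuous_intros)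
    from bounded_linear.continuous_on[OF cesaro_bounded_linear[OF t] this]
    show "continuous_on UNIV (\<lambda>p :: 'a \<times> 'a. norm (cesaro T t (snd p - frac_pre T \<alpha> w)))"
      by (rule continuous_on_norm)
    show "continuous_on UNIV (\<lambda>p :: 'a \<times> 'a. cesaro_const * t powr (- \<alpha>) * norm (fst p - w))"
      by (intro continuous_intros)
  qed
  ultimately have "frac_graph T \<alpha> \<subseteq> ?S" unfolding frac_graph_def by (rule closure_minimal)
  then show ?thesis using xy by auto
qed

section \<open>Decay of Cesaro means on the range of the fractional power\<close>

lemma frac_ran_obtain:
  assumes "y \<in> frac_ran T \<alpha>" obtains x where "(x, y) \<in> frac_graph T \<alpha>"
  using assms unfolding frac_ran_def by auto

lemma cesaro_bigo:
  assumes "y \<in> frac_ran T \<alpha>"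
  shows "(\<lambda>t. norm (cesaro T t y)) \<in> O[at_top](\<lambda>t. t powr (- \<alpha>))"
proof -
  obtain x where x: "(x, y) \<in> frac_graph T \<alpha>" using frac_ran_obtain[OF assms] .
  have 0: "0 \<in> opA_dom T" by (rule subspace_0[OF opA_dom_subspace])
  have "frac_pre T \<alpha> 0 = 0" using frac_pre_lincomb[OF 0 0, of 0 0] by simp
  then have "norm (norm (cesaro T t y)) \<le> (cesaro_const * norm x) * norm (t powr (- \<alpha>))" if "t > 0" for t
    using cesaro_frac_graph_le[OF that x 0] that by (simp add: mult_ac)
  then show ?thesis
    by (intro bigoI[of _ "cesaro_const * norm x"] eventually_mono[OF eventually_gt_at_top[of 0]])
qed

text \<open>Elements \<open>opA T z\<close> need not lie in the domain of A, where A^\<alpha> is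
  given by its integral. The multiples of \<open>z - T h z\<close> do, at the cost of a second
  approximation.\<close>

lemma opA_approx:
  assumes v: "v \<in> closure (opA_ran T)" and \<delta>: "0 < \<delta>"
  obtains h z where "0 < h" "z \<in> opA_dom T" "norm (v - inverse h *\<^sub>R (z - T h z)) < \<delta>"
proof -
  obtain z where z: "z \<in> opA_dom T" "dist (opA T z) v < \<delta> / 2"
    using v \<delta> unfolding closure_approachable opA_ran_def by (metis half_gt_zero imageE)
  have "((\<lambda>h. inverse h *\<^sub>R (T h z - z)) \<longlongrightarrow> - opA T z) (at_right 0)"
    using neg_gen_rel_opA[OF z(1)] unfolding neg_gen_rel_def .
  then have "eventually (\<lambda>h. dist (inverse h *\<^sub>R (T h z - z)) (- opA T z) < \<delta> / 2) (at_right 0)"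
    using \<delta> by (intro tendstoD) auto
  from eventually_conj[OF eventually_at_right_less this]
  obtain h where h: "h > 0" "dist (inverse h *\<^sub>R (T h z - z)) (- opA T z) < \<delta> / 2"
    using eventually_happens'[OF trivial_limit_at_right_real] by blast
  have "inverse h *\<^sub>R (z - T h z) = - (inverse h *\<^sub>R (T h z - z))"
    by (simp only: scaleR_minus_right[symmetric] minus_diff_eq)
  then have "dist (opA T z) (inverse h *\<^sub>R (z - T h z)) < \<delta> / 2"
    using h(2) dist_minus[of "inverse h *\<^sub>R (T h z - z)" "- opA T z"] by (simp add: dist_commute)
  then have "dist v (inverse h *\<^sub>R (z - T h z)) < \<delta>"
    using z(2) by (metis dist_commute dist_triangle_half_r)
  then show thesis using that[OF h(1) z(1)] by (simp add: dist_norm)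
qed

lemma cesaro_smallo:
  assumes erg: "mean_ergodic T" and y: "y \<in> frac_ran T \<alpha>"
  shows "(\<lambda>t. norm (cesaro T t y)) \<in> o[at_top](\<lambda>t. t powr (- \<alpha>))"
proof (rule landau_o.smallI)
  fix e :: real assume e: "e > 0"
  obtain x where x: "(x, y) \<in> frac_graph T \<alpha>" using frac_ran_obtain[OF y] .
  obtain u v where uv: "u \<in> opA_ker T" "v \<in> closure (opA_ran T)" "x = u + v"
    using erg unfolding mean_ergodic_def by metis
  \<comment> \<open>Half of \<open>e\<close> pays for replacing \<open>x\<close> by
    \<open>w\<close>, the other half for the term of order \<open>1 / t\<close>.\<close>
  define \<delta> where "\<delta> = e / (2 * cesaro_const)"
  have \<delta>: "\<delta> > 0" "cesaro_const * \<delta> = e / 2" using e cesaro_const_pos by (auto simp: \<delta>_def)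
  obtain h z where h: "0 < h" and z: "z \<in> opA_dom T"
    and near: "norm (v - inverse h *\<^sub>R (z - T h z)) < \<delta>"
    using opA_approx[OF uv(2) \<delta>(1)] .
  \<comment> \<open>The kernel component \<open>u\<close> is kept exactly: \<open>T s\<close> fixes
    it, so the integral for A^\<alpha> vanishes on it.\<close>
  define w where "w = u + inverse h *\<^sub>R (z - T h z)"
  have u: "u \<in> opA_dom T" using uv(1) by (simp add: opA_ker_def)
  have Tz: "T h z \<in> opA_dom T" using opA_T[OF z] h by simp
  note sub = opA_dom_subspace
  have d: "z - T h z \<in> opA_dom T" by (rule subspace_diff[OF sub z Tz])
  have w: "w \<in> opA_dom T"
    unfolding w_def by (intro subspace_add[OF sub] subspace_scale[OF sub] u d)
  let ?P = "frac_pre T \<alpha>"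
  have Pu: "?P u = 0"
  proof -
    have "integral {0<..} (\<lambda>s. s powr (- \<alpha> - 1) *\<^sub>R (u - T s u)) = integral {0<..} (\<lambda>s::real. 0::'a)"
      using opA_ker_T[OF uv(1)] by (intro integral_cong) auto
    then show ?thesis by (simp add: frac_pre_eq)
  qed
  have PT: "?P (T h z) = T h (?P z)"
  proof -
    have "integral {0<..} (\<lambda>s. s powr (- \<alpha> - 1) *\<^sub>R (T h z - T s (T h z)))
        = integral {0<..} (\<lambda>s. s powr (- \<alpha> - 1) *\<^sub>R T h (z - T s z))"
      using h by (intro integral_cong) (auto simp: T_commute[of h])
    then show ?thesis
      using bounded_linear_frac_pre[OF T_lin[OF less_imp_le[OF h]] z] by (simp only: frac_pre_eq[of "T h z"])
  qed
  have Pw: "?P w = inverse h *\<^sub>R (?P z - T h (?P z))"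
    using frac_pre_lincomb[OF u d, of 1 "inverse h"] frac_pre_lincomb[OF z Tz, of 1 "-1"] Pu PT
    by (simp add: w_def)
  define B where "B = 2 * M * norm (?P z)"
  have Pw_le: "norm (cesaro T t (?P w)) \<le> B / t" if t: "t > 0" for t
    using cesaro_orbit_diff_le[OF t, of h "?P z"] h t
    by (simp add: Pw cesaro_scaleR B_def divide_simps mult.commute)
  \<comment> \<open>In units of \<open>t powr (- \<alpha>)\<close> the bound \<open>B / t\<close>
    becomes \<open>B * t powr (\<alpha> - 1)\<close>, which tends to 0 because
    \<open>\<alpha> < 1\<close>.\<close>
  have "((\<lambda>t. B * t powr (\<alpha> - 1)) \<longlongrightarrow> B * 0) at_top"
    using \<alpha> by (intro tendsto_intros tendsto_neg_powr filterlim_ident) auto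
  then have "eventually (\<lambda>t. B * t powr (\<alpha> - 1) < e / 2) at_top"
    using e by (intro order_tendstoD) auto
  then show "eventually (\<lambda>t. norm (norm (cesaro T t y)) \<le> e * norm (t powr (- \<alpha>))) at_top"
    using eventually_gt_at_top[of 0]
  proof eventually_elim
    case (elim t)
    have "cesaro T t y = cesaro T t (y - ?P w) + cesaro T t (?P w)"
      using cesaro_add[of t "y - ?P w" "?P w"] by simp
    also have "norm \<dots> \<le> cesaro_const * t powr (- \<alpha>) * norm (x - w) + B / t"
      using elim by (intro norm_triangle_le add_mono cesaro_frac_graph_le x w Pw_le) auto
    also have "cesaro_const * t powr (- \<alpha>) * norm (x - w) \<le> cesaro_const * t powr (- \<alpha>) * \<delta>"
      using near cesaro_const_pos by (intro mult_left_mono) (auto simp: uv(3) w_def)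
    also have "\<dots> = e / 2 * t powr (- \<alpha>)" using \<delta>(2) by (simp add: mult_ac)
    also have "B / t = B * t powr (\<alpha> - 1) * t powr (- \<alpha>)"
      using elim by (simp add: powr_diff powr_minus divide_simps)
    also have "\<dots> \<le> e / 2 * t powr (- \<alpha>)" using elim by (intro mult_right_mono) auto
    finally show ?case using e by simp
  qed
qed

end

section \<open>Spectrum and approximate eigenvectors\<close>

lemma has_vector_derivative_at_right_quotient:
  fixes f :: "real \<Rightarrow> 'b::real_normed_vector"
  assumes "(f has_vector_derivative D) (at a within {a..b})" "a < b"
  shows "((\<lambda>h. inverse h *\<^sub>R (f (a + h) - f a)) \<longlongrightarrow> D) (at_right 0)"
proof -
  have "((\<lambda>y. inverse (norm (y - a)) *\<^sub>R (f y - (f a + (y - a) *\<^sub>R D))) \<longlongrightarrow> 0) (at_right a)"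
    using assms unfolding has_vector_derivative_def has_derivative_within
    by (simp add: at_within_Icc_at_right inverse_eq_divide)
  then have "((\<lambda>y. inverse (norm (y - a)) *\<^sub>R (f y - (f a + (y - a) *\<^sub>R D)) + D) \<longlongrightarrow> 0 + D) (at_right a)"
    by (intro tendsto_intros)
  then have "((\<lambda>y. inverse (y - a) *\<^sub>R (f y - f a)) \<longlongrightarrow> 0 + D) (at_right a)"
  proof (rule Lim_transform_eventually)
    have "inverse (norm (y - a)) *\<^sub>R (f y - (f a + (y - a) *\<^sub>R D)) + D = inverse (y - a) *\<^sub>R (f y - f a)"
      if "y > a" for y
      using that by (simp add: diff_diff_eq[symmetric] scaleR_diff_right)
    then show "eventually (\<lambda>y. inverse (norm (y - a)) *\<^sub>R (f y - (f a + (y - a) *\<^sub>R D)) + D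
        = inverse (y - a) *\<^sub>R (f y - f a)) (at_right a)"
      by (auto simp: eventually_at_filter)
  qed
  then show ?thesis by (subst (asm) filterlim_at_right_to_0) (simp add: add.commute)
qed

context bounded_semigroup begin

section \<open>The operator z - A: lower bounds and resolvent set\<close>

definition "zA z x = cscale J z x - opA T x"

lemma zA_lincomb:
  assumes "x \<in> opA_dom T" "y \<in> opA_dom T"
  shows "zA z (a *\<^sub>R x + b *\<^sub>R y) = a *\<^sub>R zA z x + b *\<^sub>R zA z y"
  unfolding zA_def opA_lincomb(2)[OF assms]
  by (simp add: cscale.add_right cscale.scaleR_right algebra_simps)

lemma zA_J: "x \<in> opA_dom T \<Longrightarrow> zA z (J x) = J (zA z x)"
  unfolding zA_def using opA_J(2) by (simp add: cscale_def)

lemma zA_change: "zA z x = zA w x + cscale J (z - w) x"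
  unfolding zA_def by (simp add: cscale.diff_left)

text \<open>The points \<open>z\<close> that admit no \<open>\<eta>\<close> form the approximate
  point spectrum of A.\<close>

definition "bounded_below z \<eta> \<longleftrightarrow> 0 < \<eta> \<and> (\<forall>x \<in> opA_dom T. \<eta> * norm x \<le> norm (zA z x))"

lemma bounded_belowD: "bounded_below z \<eta> \<Longrightarrow> x \<in> opA_dom T \<Longrightarrow> \<eta> * norm x \<le> norm (zA z x)"
  unfolding bounded_below_def by auto

lemma resolvent_setI:
  assumes low: "bounded_below z \<eta>" and surj: "\<And>y. \<exists>x \<in> opA_dom T. zA z x = y"
  shows "z \<in> resolvent_set J T"
proof -
  have \<eta>: "0 < \<eta>" using low unfolding bounded_below_def by simp
  obtain R where R: "\<And>y. R y \<in> opA_dom T" "\<And>y. zA z (R y) = y" using surj by metis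
  have uniq: "x = y" if "x \<in> opA_dom T" "y \<in> opA_dom T" "zA z x = zA z y" for x y
  proof -
    have "zA z (x - y) = 0" using zA_lincomb[OF that(1,2), of z 1 "-1"] that(3) by simp
    then have "\<eta> * norm (x - y) \<le> 0"
      using bounded_belowD[OF low subspace_diff[OF opA_dom_subspace that(1,2)]] by simp
    then show ?thesis using \<eta> by (simp add: mult_le_0_iff)
  qed
  have R': "R (zA z x) = x" if "x \<in> opA_dom T" for x
    by (rule uniq) (use R that in auto)
  have lin: "R (a *\<^sub>R x + b *\<^sub>R y) = a *\<^sub>R R x + b *\<^sub>R R y" for a b x y
    using R'[OF opA_lincomb(1)[OF R(1) R(1)]] by (simp add: zA_lincomb R)
  have "bounded_linear R"
  proof (rule bounded_linear_intro[where K="inverse \<eta>"])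
    show "R (x + y) = R x + R y" for x y using lin[of 1 x 1 y] by simp
    show "R (r *\<^sub>R x) = r *\<^sub>R R x" for r x using lin[of r x 0 x] by simp
    show "norm (R x) \<le> norm x * inverse \<eta>" for x
      using bounded_belowD[OF low R(1)[of x]] \<eta> by (simp add: R(2) field_simps)
  qed
  moreover have "R (J y) = J (R y)" for y
    using R'[OF opA_J(1)[OF R(1)[of y]]] by (simp add: zA_J R)
  ultimately show ?thesis
    unfolding resolvent_set_def using R R' by (auto simp: zA_def)
qed

lemma resolvent_setD:
  assumes "z \<in> resolvent_set J T"
  shows "\<exists>\<eta>. bounded_below z \<eta>" "\<exists>x \<in> opA_dom T. zA z x = y"
proof -
  obtain R where R: "bounded_linear R" "\<And>y. R y \<in> opA_dom T" "\<And>y. zA z (R y) = y"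
    "\<And>x. x \<in> opA_dom T \<Longrightarrow> R (zA z x) = x"
    using assms unfolding resolvent_set_def zA_def by blast
  obtain K where K: "K > 0" "\<And>x. norm (R x) \<le> norm x * K"
    using bounded_linear.pos_bounded[OF R(1)] by auto
  have "bounded_below z (inverse K)"
    unfolding bounded_below_def
  proof (intro conjI ballI)
    fix x assume "x \<in> opA_dom T"
    then show "inverse K * norm x \<le> norm (zA z x)"
      using K(2)[of "zA z x"] K(1) R(4) by (simp add: field_simps)
  qed (use K in simp)
  then show "\<exists>\<eta>. bounded_below z \<eta>" by blast
  show "\<exists>x \<in> opA_dom T. zA z x = y" using R by blast
qed

text \<open>The equation at \<open>z\<close> is the fixed point equation x = R (y - (z - w) x), with
  contraction factor \<open>cmod (z - w) / \<eta>\<close>. The radius depends on \<open>w\<close>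
  only through its lower bound, so a bound shared by nearby points reaches from one to the
  other.\<close>

lemma resolvent_set_ball:
  assumes w: "w \<in> resolvent_set J T" and low: "bounded_below w \<eta>" and z: "dist z w < \<eta>"
  shows "z \<in> resolvent_set J T"
proof (rule resolvent_setI)
  let ?d = "cmod (z - w)"
  have \<eta>: "0 < \<eta>" using low unfolding bounded_below_def by simp
  have d: "?d < \<eta>" using z by (simp add: dist_norm)
  show "bounded_below z (\<eta> - ?d)"
    unfolding bounded_below_def
  proof (intro conjI ballI)
    fix x assume x: "x \<in> opA_dom T"
    have "zA w x = zA z x - cscale J (z - w) x" using zA_change[of z x w] by simp
    then have "norm (zA w x) \<le> norm (zA z x) + ?d * norm x"
      using norm_triangle_ineq4[of "zA z x" "cscale J (z - w) x"] by simp
    then show "(\<eta> - ?d) * norm x \<le> norm (zA z x)"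
      using bounded_belowD[OF low x] by (simp add: algebra_simps)
  qed (use d in simp)
  fix y
  obtain R where R: "\<And>y. R y \<in> opA_dom T" "\<And>y. zA w (R y) = y" using resolvent_setD(2)[OF w] by metis
  define f where "f x = R (y - cscale J (z - w) x)" for x
  have "\<exists>!x. f x = x"
  proof (rule banach_fix_type)
    show "0 \<le> ?d / \<eta>" "?d / \<eta> < 1" using d \<eta> by auto
    show "\<forall>x x'. dist (f x) (f x') \<le> ?d / \<eta> * dist x x'"
    proof (intro allI)
      fix x x'
      have "zA w (f x - f x') = cscale J (z - w) (x' - x)"
        using zA_lincomb[of "f x" "f x'" w 1 "-1"] R by (simp add: f_def cscale.diff_right)
      then have "\<eta> * norm (f x - f x') \<le> ?d * norm (x' - x)"
        using bounded_belowD[OF low subspace_diff[OF opA_dom_subspace R(1) R(1)]]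
        unfolding f_def by (metis norm_cscale)
      then show "dist (f x) (f x') \<le> ?d / \<eta> * dist x x'"
        using \<eta> by (simp add: dist_norm norm_minus_commute field_simps)
    qed
  qed
  then obtain x where x: "f x = x" by blast
  have "zA w x = y - cscale J (z - w) x" using R(2) x unfolding f_def by metis
  then have "zA z x = y" using zA_change[of z x w] by simp
  moreover have "x \<in> opA_dom T" using R(1) x unfolding f_def by metis
  ultimately show "\<exists>x \<in> opA_dom T. zA z x = y" by blast
qed

text \<open>At this time the exponential outweighs \<open>M\<close>, and exp (a t) T t has norm at
  most 1/2.\<close>

lemma exp_decay:
  assumes "a < 0" obtains t where "0 \<le> t" "exp (a * t) * M \<le> 1 / 2"
proof -
  define t where "t = ln (2 * M) / (- a)"
  have "t \<ge> 0" using assms M by (simp add: t_def divide_nonneg_neg)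
  moreover have "exp (a * t) * M = 1 / 2"
    using assms M(1) by (simp add: t_def exp_minus field_simps)
  ultimately show thesis using that by simp
qed

text \<open>For a suitable \<open>t\<close> the operator exp (z t) T t has norm at most 1/2. So
  \<open>norm x\<close> is at most twice the distance from \<open>x\<close> to exp (z t) T t x,
  which the twisted orbit bounds by a multiple of \<open>norm (zA z x)\<close>.\<close>

lemma bounded_below_neg_Re:
  assumes "Re z < 0" shows "\<exists>\<eta>. bounded_below z \<eta>"
proof -
  obtain t where t: "0 \<le> t" "exp (Re z * t) * M \<le> 1 / 2" using exp_decay[OF assms] .
  have *: "norm x \<le> 2 * (M * t) * norm (zA z x)" if x: "x \<in> opA_dom T" for x
  proof -
    have "norm (cscale J (exp (z * of_real t)) (T t x) - x) \<le> M * norm (zA z x) * t"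
      using twisted_orbit_diff_le[OF x t(1), of z 0] assms
      by (simp add: zA_def norm_minus_commute mult_nonpos_nonneg)
    moreover have "norm (cscale J (exp (z * of_real t)) (T t x)) \<le> norm x / 2"
    proof -
      have "norm (cscale J (exp (z * of_real t)) (T t x)) \<le> exp (Re z * t) * (M * norm x)"
        using M(2)[OF t(1), of x] by (simp add: mult_left_mono)
      also have "\<dots> \<le> 1 / 2 * norm x" using t(2) unfolding mult.assoc[symmetric] by (intro mult_right_mono) auto
      finally show ?thesis by simp
    qed
    ultimately have "norm x \<le> norm x / 2 + M * norm (zA z x) * t"
      using norm_triangle_ineq2[of x "cscale J (exp (z * of_real t)) (T t x)"]
      by (simp add: norm_minus_commute)
    then show ?thesis by (simp add: mult_ac)
  qed
  \<comment> \<open>The summand 1 keeps the constant positive, as only \<open>0 \<le> t\<close> is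
    known.\<close>
  have **: "norm x \<le> (2 * (M * t) + 1) * norm (zA z x)" if "x \<in> opA_dom T" for x
    using add_increasing2[OF norm_ge_zero[of "zA z x"] *[OF that]] by (simp add: distrib_right)
  have p: "2 * (M * t) + 1 > 0" using t M_ge_0 by (simp add: add_nonneg_pos)
  have "bounded_below z (inverse (2 * (M * t) + 1))"
    unfolding bounded_below_def using ** p by (auto simp: field_simps)
  then show ?thesis by blast
qed

text \<open>Pulling \<open>T h\<close> under the integral and shifting gives
  \<open>T h x = exp (r * h) *\<^sub>R (I (t + h) - I h)\<close>, which is right differentiable at
  \<open>h = 0\<close> for arbitrary \<open>v\<close>. Truncation at \<open>t\<close> leaves the
  boundary term with \<open>T t v\<close>.\<close>

lemma opA_exp_integral:
  fixes r t :: real and v x :: 'a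
  assumes t: "0 \<le> t"
  defines "x \<equiv> integral {0..t} (\<lambda>s. exp (- r * s) *\<^sub>R T s v)"
  shows "x \<in> opA_dom T" "opA T x = v - exp (- r * t) *\<^sub>R T t v - r *\<^sub>R x"
proof -
  define g where "g s = exp (- r * s) *\<^sub>R T s v" for s
  define I where "I u = integral {0..u} g" for u
  have x: "x = I t" unfolding x_def I_def g_def ..
  have g_cont: "continuous_on A g" if "A \<subseteq> {0..}" for A
    unfolding g_def by (intro continuous_intros continuous_on_subset[OF T_cont that])
  have g_int: "g integrable_on {a..b}" if "0 \<le> a" for a b
    using that by (intro integrable_continuous_real g_cont) auto
  have dI: "(I has_vector_derivative g u) (at u within {u..u + 1})" if "0 \<le> u" for u
  proof -
    have "(I has_vector_derivative g u) (at u within {0..u + 1})"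
      unfolding I_def using that by (intro integral_has_vector_derivative g_cont) auto
    then show ?thesis by (rule has_vector_derivative_within_subset) (use that in auto)
  qed
  have dI_shift: "((\<lambda>h. I (t + h)) has_vector_derivative g t) (at 0 within {0..1})"
  proof -
    have "((\<lambda>h. t + h) has_vector_derivative 1) (at 0 within {0..1})"
      by (auto intro!: derivative_eq_intros)
    moreover have "(I has_vector_derivative g t) (at (t + 0) within (\<lambda>h. t + h) ` {0..1})"
      using dI[OF t] by (simp add: add.commute)
    ultimately show ?thesis using vector_diff_chain_within[of "\<lambda>h. t + h" 1 0 "{0..1}" I "g t"] by (simp add: o_def)
  qed
  have Th: "T h x = exp (r * h) *\<^sub>R (I (t + h) - I h)" if h: "0 \<le> h" for h
  proof -
    have "T h x = integral {0..t} (T h \<circ> g)"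
      unfolding x I_def using integral_linear[OF g_int[OF order_refl] T_lin[OF h]] by (rule sym)
    also have "\<dots> = integral {0..t} (\<lambda>s. exp (r * h) *\<^sub>R g (s + h))"
    proof (rule integral_cong)
      fix s assume "s \<in> {0..t}"
      then show "(T h \<circ> g) s = exp (r * h) *\<^sub>R g (s + h)"
        using h T_add[of h s v] by (simp add: g_def add.commute exp_add[symmetric] algebra_simps)
    qed
    also have "\<dots> = exp (r * h) *\<^sub>R integral {h..t + h} g"
      using integral_shift_real_ivl[of h h "t + h" g] by simp
    also have "integral {h..t + h} g = I (t + h) - I h"
    proof -
      have "I h + integral {h..t + h} g = I (t + h)"
        unfolding I_def using h t by (intro Henstock_Kurzweil_Integration.integral_combine g_int) auto
      then show ?thesis by (simp add: algebra_simps)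
    qed
    finally show ?thesis .
  qed
  have I0: "I 0 = 0" by (simp add: I_def)
  have "((\<lambda>h. exp (r * h) *\<^sub>R (I (t + h) - I h)) has_vector_derivative
      (exp (r * 0) *\<^sub>R (g t - g 0) + (exp (r * 0) * r) *\<^sub>R (I (t + 0) - I 0))) (at 0 within {0..1})"
  proof (rule has_vector_derivative_scaleR)
    show "((\<lambda>h. exp (r * h)) has_field_derivative exp (r * 0) * r) (at 0 within {0..1})"
      by (auto intro!: derivative_eq_intros)
    show "((\<lambda>h. I (t + h) - I h) has_vector_derivative g t - g 0) (at 0 within {0..1})"
      using dI[of 0] by (intro has_vector_derivative_diff dI_shift) simp
  qed
  then have "((\<lambda>h. exp (r * h) *\<^sub>R (I (t + h) - I h)) has_vector_derivative g t - g 0 + r *\<^sub>R x)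
      (at 0 within {0..1})"
    using x I0 by simp
  from has_vector_derivative_at_right_quotient[OF this]
  have "((\<lambda>h. inverse h *\<^sub>R (exp (r * h) *\<^sub>R (I (t + h) - I h) - x)) \<longlongrightarrow> g t - g 0 + r *\<^sub>R x) (at_right 0)"
    by (simp add: x I0)
  then have "neg_gen_rel T x (g t - g 0 + r *\<^sub>R x)"
    unfolding neg_gen_rel_def
    by (rule Lim_transform_eventually) (auto simp: eventually_at_filter Th)
  from opA_eqI[OF this] show "x \<in> opA_dom T" "opA T x = v - exp (- r * t) *\<^sub>R T t v - r *\<^sub>R x"
    by (simp_all add: g_def)
qed

text \<open>The integral up to a finite time solves the equation up to a boundary term. This term is
  absorbed by taking for \<open>v\<close> the fixed point of a contraction.\<close>

lemma neg_real_in_resolvent_set: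
  assumes r: "0 < r" shows "complex_of_real (- r) \<in> resolvent_set J T"
proof -
  obtain \<eta> where "bounded_below (of_real (- r)) \<eta>"
    using bounded_below_neg_Re[of "of_real (- r)"] r by auto
  then show ?thesis
  proof (rule resolvent_setI)
    fix y
    obtain t where t: "0 \<le> t" "exp (- r * t) * M \<le> 1 / 2" using exp_decay[of "- r"] r by auto
    have "\<exists>!v. - y + exp (- r * t) *\<^sub>R T t v = v"
    proof (rule banach_fix_type)
      show "\<forall>v w. dist (- y + exp (- r * t) *\<^sub>R T t v) (- y + exp (- r * t) *\<^sub>R T t w) \<le> 1 / 2 * dist v w"
      proof (intro allI)
        fix v w
        have "dist (- y + exp (- r * t) *\<^sub>R T t v) (- y + exp (- r * t) *\<^sub>R T t w)
            = exp (- r * t) * norm (T t (v - w))"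
          using t(1) by (simp add: dist_norm scaleR_diff_right[symmetric])
        also have "\<dots> \<le> exp (- r * t) * (M * norm (v - w))"
          using M(2)[OF t(1)] by (intro mult_left_mono) auto
        also have "\<dots> \<le> 1 / 2 * norm (v - w)"
          using t(2) unfolding mult.assoc[symmetric] by (intro mult_right_mono) auto
        finally show "dist (- y + exp (- r * t) *\<^sub>R T t v) (- y + exp (- r * t) *\<^sub>R T t w) \<le> 1 / 2 * dist v w"
          by (simp add: dist_norm)
      qed
    qed auto
    then obtain v where v: "- y + exp (- r * t) *\<^sub>R T t v = v" by blast
    define x where "x = integral {0..t} (\<lambda>s. exp (- r * s) *\<^sub>R T s v)"
    note x = opA_exp_integral[OF t(1), where r=r and v=v, folded x_def]
    have "v - exp (- r * t) *\<^sub>R T t v = - y" using v by (metis add_diff_cancel_right')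
    then have "zA (of_real (- r)) x = y"
      unfolding zA_def x(2) cscale_of_real by simp
    then show "\<exists>x \<in> opA_dom T. zA (of_real (- r)) x = y" using x(1) by blast
  qed
qed

text \<open>A circle around 0 that meets the spectrum also meets the resolvent set, on the negative axis. If
  z - A were bounded below at each of its points, its intersection with the resolvent set would be
  open and closed in it.\<close>

lemma spectrum_circle_not_bounded_below:
  assumes l: "l \<in> spectrum_A J T" "l \<noteq> 0"
  obtains z where "cmod z = cmod l" "0 \<le> Re z" "\<nexists>\<eta>. bounded_below z \<eta>"
proof (rule ccontr)
  assume no: "\<not> thesis"
  note witness = that
  define S where "S = sphere (0::complex) (cmod l)"
  let ?\<rho> = "resolvent_set J T"
  \<comment> \<open>Points with \<open>Re z < 0\<close> are bounded below in any case; the negated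
    goal covers the others.\<close>
  have low: "\<exists>\<eta>. bounded_below z \<eta>" if "z \<in> S" for z
    using no that witness[of z] bounded_below_neg_Re[of z] by (fastforce simp: S_def not_less)
  have "openin (top_of_set S) (S \<inter> ?\<rho>)"
    unfolding openin_contains_ball
  proof (intro conjI ballI)
    fix z assume z: "z \<in> S \<inter> ?\<rho>"
    then obtain \<eta> where \<eta>: "bounded_below z \<eta>" using resolvent_setD(1) by blast
    then have "ball z \<eta> \<inter> S \<subseteq> S \<inter> ?\<rho>"
      using z resolvent_set_ball[of z \<eta>] by (auto simp: dist_commute)
    then show "\<exists>e>0. ball z e \<inter> S \<subseteq> S \<inter> ?\<rho>" using \<eta> unfolding bounded_below_def by blast
  qed auto
  moreover have "openin (top_of_set S) (S - ?\<rho>)"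
    unfolding openin_contains_ball
  proof (intro conjI ballI)
    fix z assume z: "z \<in> S - ?\<rho>"
    then obtain \<eta> where \<eta>: "bounded_below z \<eta>" using low by blast
    \<comment> \<open>Half of the lower bound survives at \<open>w\<close>, and the ball of that
      radius around \<open>w\<close> still contains \<open>z\<close>. A resolvent point
      \<open>w\<close> would therefore force \<open>z\<close> into the resolvent set.\<close>
    have "w \<notin> ?\<rho>" if w: "dist z w < \<eta> / 2" for w
    proof
      assume "w \<in> ?\<rho>"
      moreover have "bounded_below w (\<eta> / 2)"
        unfolding bounded_below_def
      proof (intro conjI ballI)
        fix x assume x: "x \<in> opA_dom T"
        have "norm (zA z x) \<le> norm (zA w x) + cmod (z - w) * norm x"
          unfolding zA_change[of z x w] using norm_triangle_ineq[of "zA w x" "cscale J (z - w) x"] by simp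
        moreover have "cmod (z - w) * norm x \<le> \<eta> / 2 * norm x"
          using w by (intro mult_right_mono) (auto simp: dist_norm)
        ultimately show "\<eta> / 2 * norm x \<le> norm (zA w x)" using bounded_belowD[OF \<eta> x] by simp
      qed (use \<eta> in \<open>simp add: bounded_below_def\<close>)
      ultimately have "z \<in> ?\<rho>" using w by (rule resolvent_set_ball)
      then show False using z by simp
    qed
    then have "ball z (\<eta> / 2) \<inter> S \<subseteq> S - ?\<rho>" by auto
    moreover have "\<eta> / 2 > 0" using \<eta> unfolding bounded_below_def by simp
    ultimately show "\<exists>e>0. ball z e \<inter> S \<subseteq> S - ?\<rho>" by blast
  qed auto
  moreover have "connected S" unfolding S_def by (rule connected_sphere) simp
  moreover have "complex_of_real (- cmod l) \<in> S \<inter> ?\<rho>"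
    using neg_real_in_resolvent_set[of "cmod l"] l(2) by (simp add: S_def)
  moreover have "l \<in> S - ?\<rho>" using l(1) by (simp add: S_def spectrum_A_def)
  ultimately show False unfolding connected_openin by blast
qed

lemma approximate_eigenvector:
  assumes "\<nexists>\<eta>. bounded_below z \<eta>" and \<eta>: "0 < \<eta>"
  obtains x where "x \<in> opA_dom T" "norm x = 1" "norm (opA T x - cscale J z x) \<le> \<eta>"
proof -
  obtain x where x: "x \<in> opA_dom T" "norm (zA z x) < \<eta> * norm x"
    using assms unfolding bounded_below_def by (meson not_le)
  have n: "norm x > 0" using x(2) \<eta> by (metis mult_zero_right norm_ge_zero not_less zero_less_norm_iff norm_zero)
  define u where "u = inverse (norm x) *\<^sub>R x"
  have "u \<in> opA_dom T" unfolding u_def by (rule subspace_scale[OF opA_dom_subspace x(1)])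
  moreover have "norm u = 1" using n by (simp add: u_def)
  moreover have "zA z u = inverse (norm x) *\<^sub>R zA z x"
    using zA_lincomb[OF x(1) x(1), of z "inverse (norm x)" 0] by (simp add: u_def)
  then have "norm (zA z u) = norm (zA z x) / norm x" by (simp add: divide_inverse mult.commute)
  then have "norm (opA T u - cscale J z u) \<le> \<eta>"
    using less_imp_le[OF x(2)] n by (simp add: zA_def norm_minus_commute divide_le_eq)
  ultimately show thesis by (rule that)
qed

end

section \<open>Optimality of the rate\<close>

text \<open>The explicit tail limits the influence of later humps; for their images under A^\<alpha>
  the existence of the limit suffices.\<close>

lemma geometric_limit:
  fixes w :: "nat \<Rightarrow> 'b::banach"
  assumes \<rho>: "0 \<le> \<rho>" "\<rho> < 1" and le: "\<And>n. norm (w (Suc n) - w n) \<le> B * \<rho> ^ n"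
  obtains L where "w \<longlonglongrightarrow> L" "\<And>n. norm (L - w n) \<le> B * \<rho> ^ n / (1 - \<rho>)"
proof -
  define d where "d n = w (Suc n) - w n" for n
  have g: "summable (\<lambda>m. B * \<rho> ^ (m + n))" "(\<Sum>m. B * \<rho> ^ (m + n)) = B * \<rho> ^ n / (1 - \<rho>)" for n
  proof -
    have "(\<lambda>m. (B * \<rho> ^ n) * \<rho> ^ m) sums ((B * \<rho> ^ n) * (1 / (1 - \<rho>)))"
      using \<rho> by (intro sums_mult geometric_sums) auto
    moreover have "(B * \<rho> ^ n) * \<rho> ^ m = B * \<rho> ^ (m + n)" for m
      by (simp only: power_add mult.assoc mult.commute[of "\<rho> ^ n"])
    ultimately have "(\<lambda>m. B * \<rho> ^ (m + n)) sums (B * \<rho> ^ n / (1 - \<rho>))"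
      by (simp only: times_divide_eq_right mult_1_right)
    then show "summable (\<lambda>m. B * \<rho> ^ (m + n))" "(\<Sum>m. B * \<rho> ^ (m + n)) = B * \<rho> ^ n / (1 - \<rho>)"
      unfolding sums_iff by blast+
  qed
  have d: "norm (d m) \<le> B * \<rho> ^ m" for m using le by (simp add: d_def)
  have sd: "summable d"
  proof (rule summable_comparison_test'[OF _ d])
    show "summable (\<lambda>m. B * \<rho> ^ m)" using g(1)[of 0] by (simp only: add_0_right)
  qed
  have w: "w n = w 0 + sum d {..<n}" for n by (simp add: d_def sum_lessThan_telescope)
  have "(\<lambda>n. w 0 + sum d {..<n}) \<longlonglongrightarrow> w 0 + suminf d"
    by (intro tendsto_intros summable_LIMSEQ sd)
  moreover have "(\<lambda>n. w 0 + sum d {..<n}) = w" by (rule ext) (rule w[symmetric])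
  ultimately have "w \<longlonglongrightarrow> w 0 + suminf d" by (simp only:)
  moreover have "norm (w 0 + suminf d - w n) \<le> B * \<rho> ^ n / (1 - \<rho>)" for n
  proof -
    have "w 0 + suminf d - w n = (\<Sum>m. d (m + n))"
      unfolding suminf_split_initial_segment[OF sd, of n] w[of n] by simp
    also have "norm \<dots> \<le> (\<Sum>m. B * \<rho> ^ (m + n))"
      by (intro norm_suminf_le d g(1))
    finally show ?thesis by (simp only: g(2))
  qed
  ultimately show thesis by (rule that)
qed

text \<open>Up to the time \<open>1 / cmod z\<close> the values exp (- z s) turn by an angle of at
  most 1, which is below pi / 2, and lose at most a factor exp (- 1). Their average therefore stays
  away from 0.\<close>

lemma Re_exp_minus_ge:
  assumes "0 \<le> Re w" "cmod w \<le> 1"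
  shows "exp (- 1) * cos 1 \<le> Re (exp (- w))"
proof -
  have "\<bar>Re w\<bar> \<le> 1" "\<bar>Im w\<bar> \<le> 1" using abs_Re_le_cmod[of w] abs_Im_le_cmod[of w] assms(2) by linarith+
  moreover have "cos 1 \<le> cos \<bar>Im w\<bar>"
    using calculation pi_gt3 by (intro cos_monotone_0_pi_le) auto
  moreover have "0 < cos (1::real)" using pi_gt3 by (intro cos_gt_zero) auto
  ultimately have "exp (- 1) * cos 1 \<le> exp (- Re w) * cos \<bar>Im w\<bar>" by (intro mult_mono) auto
  then show ?thesis by (simp add: Re_exp)
qed

text \<open>A modulus of at least 1/2 forces a real or an imaginary part of absolute value at least
  1/4. The first makes the exponential decay, the second makes it rotate; either keeps its real part
  away from 1.\<close>

lemma Re_exp_minus_le: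
  assumes "0 \<le> Re w" "1 / 2 \<le> cmod w" "cmod w \<le> 1"
  shows "Re (exp (- w)) \<le> max (exp (- 1 / 4)) (cos (1 / 4))"
proof (cases "1 / 4 \<le> Re w")
  case True
  have "Re (exp (- w)) \<le> cmod (exp (- w))" by (rule complex_Re_le_cmod)
  also have "\<dots> \<le> exp (- 1 / 4)" using True by simp
  finally show ?thesis by simp
next
  case False
  then have "1 / 4 \<le> \<bar>Im w\<bar>" using cmod_le[of w] assms by linarith
  moreover have "\<bar>Im w\<bar> \<le> 1" using abs_Im_le_cmod[of w] assms(3) by linarith
  ultimately have "cos \<bar>Im w\<bar> \<le> cos (1 / 4)" "0 < cos \<bar>Im w\<bar>"
    using pi_gt3 by (intro cos_monotone_0_pi_le cos_gt_zero; linarith)+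
  moreover have "exp (- Re w) * cos \<bar>Im w\<bar> \<le> 1 * cos \<bar>Im w\<bar>"
    using calculation assms(1) by (intro mult_right_mono) auto
  moreover have "Re (exp (- w)) = exp (- Re w) * cos \<bar>Im w\<bar>" by (simp add: Re_exp)
  ultimately have "Re (exp (- w)) \<le> cos (1 / 4)" by linarith
  then show ?thesis by (rule max.coboundedI2)
qed

lemma norm_one_minus_exp_le:
  fixes w :: complex
  assumes "0 \<le> Re w" shows "norm (1 - exp (- w)) \<le> norm w" "norm (1 - exp (- w)) \<le> 2"
proof -
  have "norm (exp (- (w * of_real 1)) - exp (- (w * of_real 0))) \<le> norm w * 1"
  proof (rule has_vector_derivative_norm_diff_le[where f' = "\<lambda>u. - w * exp (- (w * of_real u))"])
    fix u :: real assume u: "u \<in> {0..1}"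
    have "((\<lambda>v. exp (- (w * v))) has_field_derivative - w * exp (- (w * of_real u))) (at (of_real u))"
      by (auto intro!: derivative_eq_intros)
    from has_vector_derivative_real_field[OF this]
    show "((\<lambda>u. exp (- (w * of_real u))) has_vector_derivative - w * exp (- (w * of_real u))) (at u within {0..1})" .
    have "norm (exp (- (w * of_real u))) \<le> 1" using u assms by simp
    then show "norm (- w * exp (- (w * of_real u))) \<le> norm w"
      unfolding norm_mult norm_minus_cancel by (intro mult_right_le_one_le) auto
  qed simp
  then show "norm (1 - exp (- w)) \<le> norm w" by (simp add: norm_minus_commute)
  have "norm (exp (- w)) \<le> 1" using assms by simp
  then show "norm (1 - exp (- w)) \<le> 2" using norm_triangle_ineq4[of 1 "exp (- w)"] unfolding norm_one by linarith
qed

lemma Re_integral: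
  assumes "f integrable_on S" shows "Re (integral S f) = integral S (\<lambda>s. Re (f s))"
  using integral_linear[OF assms bounded_linear_Re] by (simp add: o_def)

text \<open>The Cesaro mean of the scalar semigroup exp (- z s), equal to (1 - exp (- t z)) / (t z)
  for \<open>t > 0\<close> and \<open>z \<noteq> 0\<close>.\<close>

definition cesaro_symbol :: "real \<Rightarrow> complex \<Rightarrow> complex" where
  "cesaro_symbol t z = (1 / t) *\<^sub>R integral {0..t} (\<lambda>s. exp (- (z * of_real s)))"

lemma cesaro_symbol_ge:
  assumes z: "0 \<le> Re z" "cmod z = 1 / t" and t: "0 < t"
  shows "exp (- 1) * cos 1 \<le> cmod (cesaro_symbol t z)"
proof -
  let ?e = "\<lambda>s. exp (- (z * of_real s))"
  have int: "?e integrable_on {0..t}" by (intro integrable_continuous_real continuous_intros)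
  have "t * (exp (- 1) * cos 1) = integral {0..t} (\<lambda>s. exp (- 1) * cos 1)" using t by simp
  also have "\<dots> \<le> integral {0..t} (\<lambda>s. Re (?e s))"
  proof (rule integral_le)
    show "(\<lambda>s. Re (?e s)) integrable_on {0..t}" by (intro integrable_continuous_real continuous_intros)
    fix s assume s: "s \<in> {0..t}"
    show "exp (- 1) * cos 1 \<le> Re (?e s)"
      using s z t by (intro Re_exp_minus_ge) (auto simp: norm_mult)
  qed auto
  also have "\<dots> = Re (integral {0..t} ?e)" using int by (simp only: Re_integral)
  finally have "exp (- 1) * cos 1 \<le> Re (cesaro_symbol t z)"
    using t by (simp add: cesaro_symbol_def field_simps)
  then show ?thesis using complex_Re_le_cmod order_trans by blast
qed

lemma (in bounded_semigroup) cesaro_approx_eigenvector: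
  assumes x: "x \<in> opA_dom T" and z: "0 \<le> Re z" and t: "0 < t"
  shows "norm (cesaro T t x - cscale J (cesaro_symbol t z) x) \<le> M * norm (opA T x - cscale J z x) * t"
proof -
  let ?e = "\<lambda>s. exp (- (z * of_real s))"
  have int: "?e integrable_on {0..t}" by (intro integrable_continuous_real continuous_intros)
  have ce: "continuous_on {0..t} (\<lambda>s. cscale J (?e s) x)"
    by (intro cscale.continuous_on continuous_intros)
  have cT: "continuous_on {0..t} (\<lambda>s. T s x)" by (rule continuous_on_subset[OF T_cont]) auto
  have "cscale J (integral {0..t} ?e) x = integral {0..t} (\<lambda>s. cscale J (?e s) x)"
    using integral_linear[OF int cscale.bounded_linear_left[of x]] by (simp add: o_def)
  then have "cesaro T t x - cscale J (cesaro_symbol t z) x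
      = (1 / t) *\<^sub>R integral {0..t} (\<lambda>s. T s x - cscale J (?e s) x)"
    unfolding cesaro_def cesaro_symbol_def cscale.scaleR_left
    by (simp add: integral_diff integrable_continuous_real ce cT scaleR_diff_right)
  moreover have "norm (integral {0..t} (\<lambda>s. T s x - cscale J (?e s) x))
      \<le> (M * norm (opA T x - cscale J z x) * t) * (t - 0)"
  proof (rule integral_bound)
    fix s assume s: "s \<in> {0..t}"
    have "norm (T s x - cscale J (?e s) x) \<le> M * norm (opA T x - cscale J z x) * s"
      using s by (intro T_diff_cscale_exp_le x z) auto
    also have "\<dots> \<le> M * norm (opA T x - cscale J z x) * t"
      using s M_ge_0 by (intro mult_left_mono) auto
    finally show "norm (T s x - cscale J (?e s) x) \<le> M * norm (opA T x - cscale J z x) * t" .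
  qed (use t in \<open>auto intro: continuous_on_diff ce cT\<close>)
  ultimately show ?thesis using t by (simp add: divide_simps)
qed

section \<open>The symbol of the fractional power and the test vectors\<close>

context fractional_semigroup begin

text \<open>By the Bernstein formula this is the principal power z^\<alpha> for
  \<open>0 \<le> Re z\<close>. In integral form it can be compared with \<open>frac_pre\<close>
  under one integral sign.\<close>

definition frac_symbol :: "complex \<Rightarrow> complex" where
  "frac_symbol z = \<gamma> *\<^sub>R integral {0<..} (\<lambda>s. s powr (- \<alpha> - 1) *\<^sub>R (1 - exp (- (z * of_real s))))"

lemma frac_symbol_integrable:
  assumes z: "0 \<le> Re z"
  shows "(\<lambda>s. s powr (- \<alpha> - 1) *\<^sub>R (1 - exp (- (z * of_real s)))) integrable_on {0<..}"
proof (rule powr_weight_integral(1)[OF \<alpha> zero_less_one, where p="cmod z" and q=2])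
  show "continuous_on {0<..} (\<lambda>s. 1 - exp (- (z * complex_of_real s)))" by (intro continuous_intros)
  fix s :: real assume "0 < s"
  then show "cmod (1 - exp (- (z * of_real s))) \<le> cmod z * s" "cmod (1 - exp (- (z * of_real s))) \<le> 2"
    using norm_one_minus_exp_le[of "z * of_real s"] z by (auto simp: norm_mult)
qed

text \<open>For \<open>s\<close> between \<open>1 / (2 * cmod z)\<close> and
  \<open>1 / cmod z\<close> the real part of the integrand is at least the weight times the gap from
  \<open>Re_exp_minus_le\<close>, and elsewhere it is nonnegative. The final \<open>/ 2\<close> is
  the length of this interval relative to \<open>1 / cmod z\<close>.\<close>

definition "symbol_const = \<gamma> * (1 - max (exp (- 1 / 4)) (cos (1 / 4))) / 2"

lemma symbol_const_pos: "0 < symbol_const"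
proof -
  have "cos (1 / 4) < cos (0::real)" using pi_gt3 by (intro cos_monotone_0_pi) auto
  then show ?thesis using \<gamma>_pos by (simp add: symbol_const_def)
qed

lemma frac_symbol_ge:
  assumes z: "0 \<le> Re z" "z \<noteq> 0"
  shows "symbol_const * cmod z powr \<alpha> \<le> cmod (frac_symbol z)"
proof -
  let ?r = "cmod z" and ?m = "max (exp (- 1 / 4)) (cos (1 / 4)) :: real"
  let ?I = "{1 / (2 * ?r)..1 / ?r}"
  let ?f = "\<lambda>s. s powr (- \<alpha> - 1) *\<^sub>R (1 - exp (- (z * of_real s)))"
  have r: "0 < ?r" using z(2) by simp
  have I: "s > 0" "1 / 2 \<le> cmod (z * of_real s)" "cmod (z * of_real s) \<le> 1" "s \<le> 1 / ?r" if "s \<in> ?I" for s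
  proof -
    have "1 / (2 * ?r) > 0" using r by simp
    moreover have "1 / (2 * ?r) \<le> s" using that by (simp only: atLeastAtMost_iff)
    ultimately show s: "s > 0" by linarith
    show "1 / 2 \<le> cmod (z * of_real s)" "cmod (z * of_real s) \<le> 1" "s \<le> 1 / ?r"
      using that r s by (auto simp: norm_mult field_simps)
  qed
  have sub: "?I \<subseteq> {0<..}" by (intro subsetI) (simp only: greaterThan_iff I(1))
  have m: "0 \<le> 1 - ?m" using symbol_const_pos \<gamma>_pos by (simp add: symbol_const_def zero_less_mult_iff)
  have Re_int: "(\<lambda>s. Re (?f s)) integrable_on {0<..}"
    using integrable_linear[OF frac_symbol_integrable[OF z(1)] bounded_linear_Re] by (simp add: o_def)
  have nonneg: "0 \<le> Re (?f s)" if "s \<in> {0<..}" for s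
  proof -
    have "Re (exp (- (z * of_real s))) \<le> cmod (exp (- (z * of_real s)))" by (rule complex_Re_le_cmod)
    also have "\<dots> \<le> 1" using that z by simp
    finally show ?thesis by simp
  qed
  have cont: "(\<lambda>s. Re (?f s)) integrable_on ?I"
    by (rule integrable_continuous_real, rule continuous_on_subset[OF _ sub])
       (auto intro!: continuous_intros)
  have "symbol_const * ?r powr \<alpha> = \<gamma> * (((1 / ?r) powr (- \<alpha> - 1) * (1 - ?m)) * (1 / ?r - 1 / (2 * ?r)))"
    using r by (simp add: symbol_const_def powr_divide powr_diff powr_minus field_simps)
  also have "((1 / ?r) powr (- \<alpha> - 1) * (1 - ?m)) * (1 / ?r - 1 / (2 * ?r))
      = integral ?I (\<lambda>s. (1 / ?r) powr (- \<alpha> - 1) * (1 - ?m))"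
    using r by (simp add: field_simps)
  also have "\<dots> \<le> integral ?I (\<lambda>s. Re (?f s))"
  proof (rule integral_le[OF _ cont])
    fix s assume s: "s \<in> ?I"
    have "(1 / ?r) powr (- \<alpha> - 1) \<le> s powr (- \<alpha> - 1)"
      using I(1,4)[OF s] \<alpha> by (intro powr_mono2') auto
    moreover have "1 - ?m \<le> 1 - Re (exp (- (z * of_real s)))"
      using Re_exp_minus_le[OF _ I(2,3)[OF s]] I(1)[OF s] z(1) by simp
    ultimately show "(1 / ?r) powr (- \<alpha> - 1) * (1 - ?m) \<le> Re (?f s)"
      using m by (simp only: scaleR_complex.sel minus_complex.sel one_complex.sel) (intro mult_mono, auto)
  qed auto
  also have "\<dots> \<le> integral {0<..} (\<lambda>s. Re (?f s))"
    by (intro integral_subset_le sub cont Re_int ballI nonneg)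
  also have "\<gamma> * integral {0<..} (\<lambda>s. Re (?f s)) = Re (frac_symbol z)"
    unfolding frac_symbol_def using Re_integral[OF frac_symbol_integrable[OF z(1)]] by simp
  finally have "symbol_const * ?r powr \<alpha> \<le> Re (frac_symbol z)" using \<gamma>_pos by simp
  then show ?thesis using complex_Re_le_cmod order_trans by blast
qed

text \<open>The second summand does not shrink with the defect, since the two orbits may drift apart
  at large \<open>s\<close>. Hence \<open>\<tau>\<close> is left open, to be taken large before the
  defect is made small.\<close>

lemma frac_approx_eigenvector:
  assumes x: "x \<in> opA_dom T" and z: "0 \<le> Re z" and \<tau>: "0 < \<tau>"
  shows "norm (frac_pre T \<alpha> x - cscale J (frac_symbol z) x)
    \<le> \<gamma> * (M * norm (opA T x - cscale J z x) * (\<tau> powr (1 - \<alpha>) / (1 - \<alpha>))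
          + (M + 1) * norm x * (\<tau> powr (- \<alpha>) / \<alpha>))"
proof -
  let ?w = "\<lambda>s. s powr (- \<alpha> - 1)" and ?e = "\<lambda>s. exp (- (z * of_real s))"
  have lin: "bounded_linear (\<lambda>a. cscale J a x)" by (rule cscale.bounded_linear_left)
  note int = integrable_linear[OF frac_symbol_integrable[OF z] lin, unfolded o_def]
  have "cscale J (frac_symbol z) x = \<gamma> *\<^sub>R integral {0<..} (\<lambda>s. cscale J (?w s *\<^sub>R (1 - ?e s)) x)"
    unfolding frac_symbol_def cscale.scaleR_left[of \<gamma>]
    using integral_linear[OF frac_symbol_integrable[OF z] lin] by (simp only: o_def)
  then have "frac_pre T \<alpha> x - cscale J (frac_symbol z) x
      = \<gamma> *\<^sub>R integral {0<..} (\<lambda>s. ?w s *\<^sub>R (x - T s x) - cscale J (?w s *\<^sub>R (1 - ?e s)) x)"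
    by (simp only: frac_pre_eq scaleR_diff_right[symmetric] integral_diff[OF frac_integrable[OF x] int])
  also have "(\<lambda>s. ?w s *\<^sub>R (x - T s x) - cscale J (?w s *\<^sub>R (1 - ?e s)) x)
      = (\<lambda>s. ?w s *\<^sub>R (cscale J (?e s) x - T s x))"
    by (rule ext) (simp add: cscale.scaleR_left cscale.diff_left scaleR_diff_right)
  also have "norm (\<gamma> *\<^sub>R integral {0<..} (\<lambda>s. ?w s *\<^sub>R (cscale J (?e s) x - T s x)))
      = \<gamma> * norm (integral {0<..} (\<lambda>s. ?w s *\<^sub>R (cscale J (?e s) x - T s x)))"
    using \<gamma>_pos by simp
  also have "norm (integral {0<..} (\<lambda>s. ?w s *\<^sub>R (cscale J (?e s) x - T s x)))
      \<le> M * norm (opA T x - cscale J z x) * (\<tau> powr (1 - \<alpha>) / (1 - \<alpha>))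
          + (M + 1) * norm x * (\<tau> powr (- \<alpha>) / \<alpha>)"
  proof (rule powr_weight_integral(2)[OF \<alpha> \<tau>])
    show "continuous_on {0<..} (\<lambda>s. cscale J (?e s) x - T s x)"
      by (intro continuous_on_diff cscale.continuous_on continuous_intros T_cont') auto
    fix s :: real assume s: "0 < s"
    show "norm (cscale J (?e s) x - T s x) \<le> M * norm (opA T x - cscale J z x) * s"
      using T_diff_cscale_exp_le[OF x z, of s] s by (simp add: norm_minus_commute)
    have "cmod (?e s) * norm x \<le> 1 * norm x" using s z by (intro mult_right_mono) auto
    then show "norm (cscale J (?e s) x - T s x) \<le> (M + 1) * norm x"
      using M(2)[of s x] s norm_triangle_ineq4[of "cscale J (?e s) x" "T s x"]
      by (simp add: distrib_right)
  qed
  finally show ?thesis using \<gamma>_pos by simp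
qed

text \<open>From the product of the lower bounds for the two symbols, one factor 1/2 is spent on the
  error of the Cesaro mean and one on the error of A^\<alpha>.\<close>

definition "test_const = exp (- 1) * cos 1 * symbol_const / 4"

text \<open>The bound \<open>frac_pre_norm_le\<close> for \<open>norm x = 1\<close> and
  \<open>norm (opA T x) \<le> 2\<close>.\<close>

definition "test_bound = \<gamma> * (2 * M / (1 - \<alpha>) + 2 * M / \<alpha>)"

lemma test_const_pos: "0 < test_const"
proof -
  have "0 < cos (1::real)" using pi_gt3 by (intro cos_gt_zero) auto
  then show ?thesis unfolding test_const_def using symbol_const_pos by simp
qed

lemma spectral_test_vector:
  assumes l: "l \<in> spectrum_A J T" "l \<noteq> 0" "cmod l \<le> 1" and t: "t = 1 / cmod l"
  obtains x where "x \<in> opA_dom T" "norm x = 1" "norm (frac_pre T \<alpha> x) \<le> test_bound"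
    "test_const * t powr (- \<alpha>) \<le> norm (cesaro T t (frac_pre T \<alpha> x))"
proof -
  obtain z where z: "cmod z = cmod l" "0 \<le> Re z" and nb: "\<nexists>\<eta>. bounded_below z \<eta>"
    using spectrum_circle_not_bounded_below[OF l(1,2)] .
  have t0: "0 < t" using l(2) t by simp
  have zt: "cmod z = 1 / t" "z \<noteq> 0" using z(1) t l(2) by auto
  define k1 :: real where "k1 = exp (- 1) * cos 1"
  have k1: "0 < k1" using test_const_pos symbol_const_pos unfolding test_const_def k1_def by (simp add: zero_less_mult_iff)
  \<comment> \<open>The divisor accounts for the two summands of
    \<open>frac_approx_eigenvector\<close>, the bound \<open>M\<close> of the Cesaro mean and the
    prefactor \<open>\<gamma>\<close>.\<close>
  define \<delta> where "\<delta> = test_const * t powr (- \<alpha>) / (2 * M * \<gamma>)"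
  have \<delta>: "0 < \<delta>" "\<gamma> * (\<delta> + \<delta>) * M = test_const * t powr (- \<alpha>)"
    using test_const_pos M(1) \<gamma>_pos t0 by (auto simp: \<delta>_def field_simps)
  have "((\<lambda>\<tau>. (M + 1) * (\<tau> powr (- \<alpha>) / \<alpha>)) \<longlongrightarrow> (M + 1) * (0 / \<alpha>)) at_top"
    using \<alpha> by (intro tendsto_intros tendsto_neg_powr filterlim_ident) auto
  then have "eventually (\<lambda>\<tau>. (M + 1) * (\<tau> powr (- \<alpha>) / \<alpha>) < \<delta>) at_top"
    using \<delta>(1) by (intro order_tendstoD) auto
  from eventually_conj[OF this eventually_gt_at_top[of 0]]
  obtain \<tau> where \<tau>: "0 < \<tau>" "(M + 1) * (\<tau> powr (- \<alpha>) / \<alpha>) < \<delta>"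
    using eventually_happens'[OF trivial_limit_at_top_linorder] by blast
  define b where "b = M * (\<tau> powr (1 - \<alpha>) / (1 - \<alpha>))"
  have b: "0 < b" using \<tau>(1) M(1) \<alpha> by (simp add: b_def)
  \<comment> \<open>The three bounds serve \<open>norm (opA T x) \<le> 2\<close>, the error of the
    Cesaro mean, and the part of the error of A^\<alpha> near 0.\<close>
  define \<eta> where "\<eta> = min 1 (min (k1 / (2 * M * t)) (\<delta> / b))"
  have \<eta>: "0 < \<eta>" "\<eta> \<le> 1" using k1 M(1) t0 \<delta>(1) b by (auto simp: \<eta>_def)
  have "\<eta> \<le> k1 / (2 * M * t)" "\<eta> \<le> \<delta> / b" by (auto simp: \<eta>_def)
  then have \<eta>': "M * \<eta> * t \<le> k1 / 2" "\<eta> * b \<le> \<delta>"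
    using M(1) t0 b by (auto simp: field_simps)
  obtain x where x: "x \<in> opA_dom T" "norm x = 1" and near: "norm (opA T x - cscale J z x) \<le> \<eta>"
    using approximate_eigenvector[OF nb \<eta>(1)] .
  let ?P = "frac_pre T \<alpha> x" and ?L = "frac_symbol z"
  have "norm (opA T x) \<le> cmod z + \<eta>"
    using near norm_triangle_sub[of "opA T x" "cscale J z x"] x(2) by simp
  then have A: "norm (opA T x) \<le> 2" using \<eta>(2) z(1) l(3) by simp
  have P: "norm ?P \<le> test_bound"
  proof -
    have "M * norm (opA T x) / (1 - \<alpha>) \<le> 2 * M / (1 - \<alpha>)"
      using A M_ge_0 \<alpha> by (intro divide_right_mono) (auto simp: mult.commute[of M] mult_right_mono)
    then have "\<gamma> * (M * norm (opA T x) / (1 - \<alpha>) + 2 * M * norm x / \<alpha>) \<le> test_bound"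
      unfolding test_bound_def x(2) using \<gamma>_pos by (intro mult_left_mono add_mono) auto
    with frac_pre_norm_le[OF x(1)] show ?thesis by (rule order_trans)
  qed
  define E where "E = ?P - cscale J ?L x"
  have E: "M * norm E \<le> test_const * t powr (- \<alpha>)"
  proof -
    have "M * norm (opA T x - cscale J z x) * (\<tau> powr (1 - \<alpha>) / (1 - \<alpha>)) \<le> \<eta> * b"
      using mult_right_mono[OF near less_imp_le[OF b]] by (simp add: b_def mult_ac)
    then have "norm E \<le> \<gamma> * (\<delta> + \<delta>)"
      unfolding E_def using x(2) \<tau>(2) \<eta>'(2) \<gamma>_pos
      by (intro order_trans[OF frac_approx_eigenvector[OF x(1) z(2) \<tau>(1)]] mult_left_mono add_mono) auto
    then have "norm E * M \<le> \<gamma> * (\<delta> + \<delta>) * M" using M_ge_0 by (rule mult_right_mono)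
    then show ?thesis unfolding \<delta>(2) by (simp only: mult.commute)
  qed
  \<comment> \<open>The defect of \<open>u\<close> is that of \<open>x\<close> times
    \<open>cmod ?L\<close>. The Cesaro error is thus relative to \<open>cmod ?L\<close>, and half of
    the lower bound for the Cesaro symbol survives.\<close>
  define u where "u = cscale J ?L x"
  have u: "u \<in> opA_dom T" "opA T u - cscale J z u = cscale J ?L (opA T x - cscale J z x)" "norm u = cmod ?L"
    using opA_cscale[OF x(1), of ?L] x(2)
    by (simp_all add: u_def cscale.diff_right cscale_cscale mult.commute)
  have "norm (cesaro T t u - cscale J (cesaro_symbol t z) u)
      \<le> M * (cmod ?L * norm (opA T x - cscale J z x)) * t"
    using cesaro_approx_eigenvector[OF u(1) z(2) t0] unfolding u(2) norm_cscale .
  also have "\<dots> \<le> M * (cmod ?L * \<eta>) * t"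
    using near M_ge_0 t0 by (intro mult_right_mono mult_left_mono) auto
  also have "\<dots> \<le> cmod ?L * (k1 / 2)"
    using mult_left_mono[OF \<eta>'(1), of "cmod ?L"] by (simp add: mult_ac)
  finally have "cmod (cesaro_symbol t z) * cmod ?L - cmod ?L * (k1 / 2) \<le> norm (cesaro T t u)"
    using norm_triangle_ineq2[of "cscale J (cesaro_symbol t z) u" "cesaro T t u"] u(3)
    by (simp add: norm_minus_commute)
  moreover have "k1 * cmod ?L \<le> cmod (cesaro_symbol t z) * cmod ?L"
    unfolding k1_def by (intro mult_right_mono cesaro_symbol_ge z zt t0) auto
  ultimately have "k1 / 2 * cmod ?L \<le> norm (cesaro T t u)" by (simp add: mult.commute)
  moreover have "symbol_const * t powr (- \<alpha>) \<le> cmod ?L"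
    using frac_symbol_ge[OF z(2) zt(2)] t0 by (simp add: zt(1) powr_divide powr_minus_divide)
  then have "k1 / 2 * (symbol_const * t powr (- \<alpha>)) \<le> k1 / 2 * cmod ?L" using k1 by (intro mult_left_mono) auto
  then have "2 * (test_const * t powr (- \<alpha>)) \<le> k1 / 2 * cmod ?L" by (simp add: test_const_def k1_def mult_ac)
  ultimately have "2 * (test_const * t powr (- \<alpha>)) \<le> norm (cesaro T t u)" by linarith
  moreover have "norm (cesaro T t u) \<le> norm (cesaro T t ?P) + M * norm E"
  proof -
    have "cesaro T t ?P = cesaro T t u + cesaro T t E"
      unfolding cesaro_add[symmetric] by (simp add: u_def E_def)
    then show ?thesis
      using cesaro_norm_le[OF t0, of E] norm_triangle_ineq4[of "cesaro T t ?P" "cesaro T t E"] by simp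
  qed
  ultimately have "test_const * t powr (- \<alpha>) \<le> norm (cesaro T t ?P)" using E by linarith
  then show thesis using that x P by blast
qed

text \<open>Gliding hump: the sign in each step is chosen so that the new term, of size \<open>\<rho> ^ n\<close>, is not
  cancelled by the earlier ones at time \<open>t n\<close>; \<open>\<rho>\<close> is so small that the later ones cannot do so.\<close>

lemma gliding_hump:
  fixes x :: "nat \<Rightarrow> 'a" and t :: "nat \<Rightarrow> real"
  defines "\<rho> \<equiv> test_const / (test_const + 2 * cesaro_const)"
  assumes x: "\<And>n. x n \<in> opA_dom T" "\<And>n. norm (x n) = 1" "\<And>n. norm (frac_pre T \<alpha> (x n)) \<le> test_bound"
    and t: "\<And>n. 0 < t n"
    and low: "\<And>n. test_const * t n powr (- \<alpha>) \<le> norm (cesaro T (t n) (frac_pre T \<alpha> (x n)))"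
  obtains y where "y \<in> frac_ran T \<alpha>"
    "\<And>n. \<rho> ^ n * (test_const / 2) * t n powr (- \<alpha>) \<le> norm (cesaro T (t n) y)"
proof -
  let ?P = "frac_pre T \<alpha>" and ?C = "\<lambda>n. cesaro T (t n)"
  note sub = opA_dom_subspace
  \<comment> \<open>The value of \<rho> solves
    \<open>cesaro_const * (\<rho> / (1 - \<rho>)) = test_const / 2\<close>: later terms may take
    away half of what the n-th one achieves.\<close>
  have "1 - \<rho> = 2 * cesaro_const / (test_const + 2 * cesaro_const)" using test_const_pos cesaro_const_pos by (simp add: \<rho>_def field_simps)
  then have \<rho>: "0 < \<rho>" "\<rho> < 1" "cesaro_const * (\<rho> / (1 - \<rho>)) = test_const / 2"
    using test_const_pos cesaro_const_pos by (auto simp: \<rho>_def)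
  let ?Q = "\<lambda>n v w. (\<exists>s. \<bar>s\<bar> = \<rho> ^ n \<and> w = v + s *\<^sub>R x n) \<and> \<rho> ^ n * norm (?C n (?P (x n))) \<le> norm (?C n (?P w))"
  have "\<exists>w. \<forall>n. w n \<in> opA_dom T \<and> ?Q n (w n) (w (Suc n))"
  proof (rule dependent_nat_choice)
    show "\<exists>v. v \<in> opA_dom T" using x(1) by blast
    fix v n assume v: "v \<in> opA_dom T"
    define a where "a = \<rho> ^ n"
    have a: "0 < a" using \<rho>(1) by (simp add: a_def)
    let ?u = "?C n (?P (x n))"
    have eq: "?C n (?P (v + s *\<^sub>R x n)) = ?C n (?P v) + s *\<^sub>R ?u" for s
      using frac_pre_lincomb[OF v x(1)[of n], of 1 s] by (simp add: cesaro_add cesaro_scaleR)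
    \<comment> \<open>The two candidates differ by \<open>2 * a\<close> times \<open>?u\<close>, so
      one of them has norm at least \<open>a * norm ?u\<close>, whatever the earlier terms
      are.\<close>
    have "2 * (a * norm ?u) = norm ((?C n (?P v) + a *\<^sub>R ?u) - (?C n (?P v) + (- a) *\<^sub>R ?u))"
      using a by (simp add: scaleR_left_distrib[symmetric])
    also have "\<dots> \<le> norm (?C n (?P v) + a *\<^sub>R ?u) + norm (?C n (?P v) + (- a) *\<^sub>R ?u)"
      by (rule norm_triangle_ineq4)
    finally have "a * norm ?u \<le> norm (?C n (?P v) + a *\<^sub>R ?u) \<or> a * norm ?u \<le> norm (?C n (?P v) + (- a) *\<^sub>R ?u)"
      by linarith
    then obtain s where s: "s = a \<or> s = - a" "a * norm ?u \<le> norm (?C n (?P v) + s *\<^sub>R ?u)"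
      by blast
    have "v + s *\<^sub>R x n \<in> opA_dom T" by (intro subspace_add[OF sub] subspace_scale[OF sub] v x)
    moreover have "?Q n v (v + s *\<^sub>R x n)"
    proof
      have "\<bar>s\<bar> = \<rho> ^ n" using s(1) a by (auto simp: a_def)
      then show "\<exists>s'. \<bar>s'\<bar> = \<rho> ^ n \<and> v + s *\<^sub>R x n = v + s' *\<^sub>R x n" by blast
      show "\<rho> ^ n * norm ?u \<le> norm (?C n (?P (v + s *\<^sub>R x n)))" using s(2) unfolding eq a_def .
    qed
    ultimately show "\<exists>w. w \<in> opA_dom T \<and> ?Q n v w" by blast
  qed
  then obtain w where w: "\<And>n. w n \<in> opA_dom T" "\<And>n. ?Q n (w n) (w (Suc n))" by blast
  have step: "norm (w (Suc n) - w n) \<le> 1 * \<rho> ^ n" "norm (?P (w (Suc n)) - ?P (w n)) \<le> test_bound * \<rho> ^ n" for n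
  proof -
    obtain s where s: "\<bar>s\<bar> = \<rho> ^ n" "w (Suc n) = w n + s *\<^sub>R x n" using w(2) by blast
    show "norm (w (Suc n) - w n) \<le> 1 * \<rho> ^ n" using s x(2) by simp
    have "?P (w (Suc n)) - ?P (w n) = s *\<^sub>R ?P (x n)"
      using frac_pre_lincomb[OF w(1)[of n] x(1)[of n], of 1 s] s(2) by simp
    then show "norm (?P (w (Suc n)) - ?P (w n)) \<le> test_bound * \<rho> ^ n"
      using s(1) x(3)[of n] \<rho>(1) by (simp add: mult.commute mult_left_mono)
  qed
  obtain L where L: "w \<longlonglongrightarrow> L" "\<And>n. norm (L - w n) \<le> 1 * \<rho> ^ n / (1 - \<rho>)"
    using geometric_limit[of \<rho> w, OF _ \<rho>(2) step(1)] \<rho>(1) by auto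
  obtain y where y: "(\<lambda>n. ?P (w n)) \<longlonglongrightarrow> y"
    using geometric_limit[of \<rho> "\<lambda>n. ?P (w n)", OF _ \<rho>(2) step(2)] \<rho>(1) by auto
  \<comment> \<open>Vectors and images converge together, so the limit pair lies in the closure that
    defines A^\<alpha>.\<close>
  have Ly: "(L, y) \<in> frac_graph T \<alpha>"
    unfolding frac_graph_def closure_sequential
    by (intro exI[of _ "\<lambda>n. (w n, ?P (w n))"] conjI tendsto_Pair L y) (use w in auto)
  have "\<rho> ^ n * (test_const / 2) * t n powr (- \<alpha>) \<le> norm (?C n y)" for n
  proof -
    \<comment> \<open>The n-th term enters in the passage to \<open>w (Suc n)\<close>. The tail
      after it starts at \<open>\<rho> ^ Suc n\<close>, and this extra factor gives the numerator of
      \<open>\<rho> / (1 - \<rho>)\<close>.\<close>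
    have "norm (?C n (y - ?P (w (Suc n)))) \<le> cesaro_const * t n powr (- \<alpha>) * norm (L - w (Suc n))"
      by (rule cesaro_frac_graph_le[OF t Ly w(1)])
    also have "\<dots> \<le> cesaro_const * t n powr (- \<alpha>) * (1 * \<rho> ^ Suc n / (1 - \<rho>))"
      using cesaro_const_pos by (intro mult_left_mono L(2)) auto
    also have "\<dots> = cesaro_const * (\<rho> / (1 - \<rho>)) * (\<rho> ^ n * t n powr (- \<alpha>))" by (simp add: mult_ac)
    also have "\<dots> = \<rho> ^ n * (test_const / 2) * t n powr (- \<alpha>)" unfolding \<rho>(3) by simp
    finally have 1: "norm (?C n (y - ?P (w (Suc n)))) \<le> \<rho> ^ n * (test_const / 2) * t n powr (- \<alpha>)" .
    have "\<rho> ^ n * (test_const * t n powr (- \<alpha>)) \<le> \<rho> ^ n * norm (?C n (?P (x n)))"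
      using low \<rho>(1) by (intro mult_left_mono) auto
    also have "\<dots> \<le> norm (?C n (?P (w (Suc n))))" using w(2) by blast
    finally have 2: "\<rho> ^ n * (test_const * t n powr (- \<alpha>)) \<le> norm (?C n (?P (w (Suc n))))" .
    have "?C n y = ?C n (?P (w (Suc n))) + ?C n (y - ?P (w (Suc n)))"
      using cesaro_add[of "t n" "?P (w (Suc n))" "y - ?P (w (Suc n))"] by simp
    then show ?thesis
      using 1 2 norm_diff_ineq[of "?C n (?P (w (Suc n)))" "?C n (y - ?P (w (Suc n)))"] by (simp add: algebra_simps)
  qed
  then show thesis using that Ly unfolding frac_ran_def by force
qed

lemma cesaro_decay_optimal:
  fixes \<epsilon> :: "real \<Rightarrow> real"
  assumes spec: "0 islimpt spectrum_A J T"
    and \<epsilon>: "\<And>t. 0 < t \<Longrightarrow> 0 < \<epsilon> t" "(\<epsilon> \<longlongrightarrow> 0) at_top"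
  shows "\<exists>y \<in> frac_ran T \<alpha>. \<not> bdd_above ((\<lambda>t. t powr \<alpha> * norm (cesaro T t y) / \<epsilon> t) ` {1..})"
proof -
  define \<rho> where "\<rho> = test_const / (test_const + 2 * cesaro_const)"
  have \<rho>: "0 < \<rho>" using test_const_pos cesaro_const_pos by (simp add: \<rho>_def)
  have "\<exists>t x. 1 \<le> t \<and> \<epsilon> t < \<rho> ^ n / real (Suc n) \<and> x \<in> opA_dom T \<and> norm x = 1 \<and> norm (frac_pre T \<alpha> x) \<le> test_bound \<and>
      test_const * t powr (- \<alpha>) \<le> norm (cesaro T t (frac_pre T \<alpha> x))" for n
  proof -
    have "eventually (\<lambda>t. \<epsilon> t < \<rho> ^ n / real (Suc n)) at_top"
      using \<epsilon>(2) \<rho> by (intro order_tendstoD) auto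
    then obtain B where B: "\<And>t. B \<le> t \<Longrightarrow> \<epsilon> t < \<rho> ^ n / real (Suc n)"
      unfolding eventually_at_top_linorder by auto
    \<comment> \<open>\<open>1 \<le> m\<close> secures \<open>cmod l \<le> 1\<close>, as the test
      vector requires, and \<open>B \<le> m\<close> makes \<epsilon> small at
      \<open>1 / cmod l\<close>.\<close>
    define m where "m = max 1 B"
    have m: "1 \<le> m" "B \<le> m" by (auto simp: m_def)
    define d where "d = 1 / m"
    have "0 < d" using m by (simp add: d_def)
    then obtain l where l: "l \<in> spectrum_A J T" "l \<noteq> 0" "cmod l < d"
      using spec unfolding islimpt_approachable by (auto simp: dist_norm)
    have "d \<le> 1" using m by (simp add: d_def)
    then have l1: "cmod l \<le> 1" using l(3) by linarith
    have "m \<le> 1 / cmod l" using l m by (simp add: d_def field_simps)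
    then have "1 \<le> 1 / cmod l" "\<epsilon> (1 / cmod l) < \<rho> ^ n / real (Suc n)" 
      using order_trans[OF m(1)] B[OF order_trans[OF m(2)]] by blast+
    then show ?thesis using spectral_test_vector[OF l(1,2) l1 refl] by metis
  qed
  then obtain t x where t: "\<And>n. 1 \<le> t n" "\<And>n. \<epsilon> (t n) < \<rho> ^ n / real (Suc n)"
    and x: "\<And>n. x n \<in> opA_dom T" "\<And>n. norm (x n) = 1" "\<And>n. norm (frac_pre T \<alpha> (x n)) \<le> test_bound"
    and low: "\<And>n. test_const * t n powr (- \<alpha>) \<le> norm (cesaro T (t n) (frac_pre T \<alpha> (x n)))"
    by metis
  have t0: "0 < t n" for n using t(1)[of n] by simp
  obtain y where y: "y \<in> frac_ran T \<alpha>" "\<And>n. \<rho> ^ n * (test_const / 2) * t n powr (- \<alpha>) \<le> norm (cesaro T (t n) y)"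
    using gliding_hump[where x=x and t=t, OF x t0 low, folded \<rho>_def] by blast
  have big: "test_const / 2 * real (Suc n) \<le> t n powr \<alpha> * norm (cesaro T (t n) y) / \<epsilon> (t n)" for n
  proof -
    have e: "0 < \<epsilon> (t n)" using \<epsilon>(1) t0 by blast
    \<comment> \<open>The size \<rho>^n of the n-th term cancels against the bound on
      \<open>\<epsilon> (t n)\<close>, and the unbounded factor \<open>Suc n\<close>
      remains.\<close>
    have "test_const / 2 * real (Suc n) * \<epsilon> (t n) \<le> test_const / 2 * real (Suc n) * (\<rho> ^ n / real (Suc n))"
      using t(2)[of n] test_const_pos by (intro mult_left_mono) auto
    also have "\<dots> = t n powr \<alpha> * (\<rho> ^ n * (test_const / 2) * t n powr (- \<alpha>))"
      using t0[of n] by (simp add: powr_minus del: of_nat_Suc)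
    also have "\<dots> \<le> t n powr \<alpha> * norm (cesaro T (t n) y)" by (intro mult_left_mono y) auto
    finally show ?thesis using e by (simp add: pos_le_divide_eq)
  qed
  have "\<not> bdd_above ((\<lambda>t. t powr \<alpha> * norm (cesaro T t y) / \<epsilon> t) ` {1..})"
  proof
    assume "bdd_above ((\<lambda>t. t powr \<alpha> * norm (cesaro T t y) / \<epsilon> t) ` {1..})"
    then obtain B where B: "\<And>t. 1 \<le> t \<Longrightarrow> t powr \<alpha> * norm (cesaro T t y) / \<epsilon> t \<le> B"
      unfolding bdd_above_def by auto
    obtain n where "B / (test_const / 2) < real n" using reals_Archimedean2 by blast
    then have "B < test_const / 2 * real (Suc n)" using test_const_pos by (simp add: field_simps)
    then show False using big[of n] B[OF t(1)[of n]] by linarith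
  qed
  then show ?thesis using y(1) by (rule bexI)
qed

end

theorem theorem5p1:
  fixes J :: "'a::banach \<Rightarrow> 'a" and T :: "real \<Rightarrow> 'a \<Rightarrow> 'a" and \<alpha> :: real
  assumes J: "complex_structure J"
    and T: "bounded_C0_semigroup J T"
    and \<alpha>: "0 < \<alpha>" "\<alpha> < 1"
  shows "(\<forall>x \<in> frac_ran T \<alpha>. (\<lambda>t. norm (cesaro T t x)) \<in> O[at_top](\<lambda>t. t powr (- \<alpha>))) \<and>
         (mean_ergodic T \<longrightarrow>
           (\<forall>x \<in> frac_ran T \<alpha>. (\<lambda>t. norm (cesaro T t x)) \<in> o[at_top](\<lambda>t. t powr (- \<alpha>)))) \<and>
         (0 islimpt spectrum_A J T \<longrightarrow>
           (\<forall>\<epsilon> :: real \<Rightarrow> real.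
              (\<forall>s t. 0 < s \<longrightarrow> s \<le> t \<longrightarrow> \<epsilon> t \<le> \<epsilon> s) \<longrightarrow>
              (\<forall>t>0. 0 < \<epsilon> t) \<longrightarrow>
              (\<epsilon> \<longlongrightarrow> 0) at_top \<longrightarrow>
              (\<exists>y \<in> frac_ran T \<alpha>.
                 \<not> bdd_above ((\<lambda>t. t powr \<alpha> * norm (cesaro T t y) / \<epsilon> t) ` {1..}))))"
proof -
  obtain M where M: "\<And>t x. 0 \<le> t \<Longrightarrow> norm (T t x) \<le> M * norm x"
    using T unfolding bounded_C0_semigroup_def by blast
  interpret fractional_semigroup J T "max 1 M" \<alpha>
  proof
    fix t :: real and x :: 'a assume "0 \<le> t"
    then have "norm (T t x) \<le> M * norm x" by (rule M)
    also have "\<dots> \<le> max 1 M * norm x" by (intro mult_right_mono) auto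
    finally show "norm (T t x) \<le> max 1 M * norm x" .
  qed (use J T \<alpha> in auto)
  show ?thesis using cesaro_bigo cesaro_smallo cesaro_decay_optimal by blast
qed

end
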